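(* Let $k$ be an algebraically closed field of characteristic $0$, let $N\ge 1$, and let $A\in\mathrm{GL}_N(k[x])$. Let $V$ be a periodic subvariety of $\mathbb{A}^1_k\times\mathbb{A}^N_k$ under $f_A$, of period $m$. Then $m$ divides the number of connected components of $\mathbb{G}_A$. In particular, the period of each periodic subvariety of $\mathbb{A}^1_k\times \mathbb{A}^N_k$ under the action of $f_A$ is uniformly bounded by a constant depending only on $A$.
   Context: Subvarieties are Zariski closed. For $A\in\mathrm{GL}_N(k[x])$ let $f_A:\mathbb{A}^1_k\times\mathbb{A}^N_k \to \mathbb{A}^1_k\times\mathbb{A}^N_k$ be the automorphism $(x,y)\mapsto (x+1, A(x)y)$. An irreducible subvariety $V$ is periodic under $f_A$ if $f_A^n(V)=V$ for some integer $n\ge 1$; its period is the smallest such $n$. Let $\pi:\mathbb{A}^1_k\times\mathbb{A}^N_k\to\mathbb{A}^1_k$ be the projection. $I_A$ is the set of all (not necessarily irreducible) subvarieties $V$ of $\mathbb{A}^1_k\times \mathbb{A}_k^{N}$ which dominate $\mathbb{A}^1_k$ under $\pi$ and are invariant under $f_A$ (i.e. $f_A(V)=V$). Let $r_0(V):=V\cap \pi^{-1}(0)$, viewed as a subvariety of $\mathbb{A}^N_k$. For a subvariety $W\subseteq\mathbb{A}^N_k$, $G_W$ is the subgroup of $\mathrm{GL}_N$ of elements $\gamma$ with $\gamma(W)=W$, and $\mathbb{G}_A:=\bigcap_{W\in r_0(I_A)}G_W$, an algebraic subgroup of $\mathrm{GL}_N$. *)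

theory Defs
  imports
    "HOL-Analysis.Analysis"
    "HOL-Library.Poly_Mapping"
    "HOL-Computational_Algebra.Polynomial"
begin

text \<open>
  Polynomials in the variables \<^typ>\<open>'v\<close> are finitely supported maps from exponent vectors
  to coefficients, with the ring structure of \<^theory>\<open>HOL-Library.Poly_Mapping\<close>.
\<close>

type_synonym ('v, 'a) mpoly = "('v \<Rightarrow>\<^sub>0 nat) \<Rightarrow>\<^sub>0 'a"

definition mpoly_eval :: "('v::finite, 'a::comm_ring_1) mpoly \<Rightarrow> ('v \<Rightarrow> 'a) \<Rightarrow> 'a" where
  "mpoly_eval p c =
     (\<Sum>m\<in>Poly_Mapping.keys p.
        Poly_Mapping.lookup p m * (\<Prod>v\<in>UNIV. c v ^ Poly_Mapping.lookup m v))"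

text \<open>
  Affine spaces over an algebraically closed field are identified with their sets of rational
  points. A type \<^typ>\<open>'p\<close> of points carries a coordinate map \<open>c\<close>, and a set of points is Zariski
  closed if it is the common zero locus of a set of polynomials in these coordinates.
\<close>

definition zero_locus ::
  "('p \<Rightarrow> 'v::finite \<Rightarrow> 'a::idom) \<Rightarrow> ('v, 'a) mpoly set \<Rightarrow> 'p set" where
  "zero_locus c S = {P. \<forall>f\<in>S. mpoly_eval f (c P) = 0}"

definition zariski :: "('p \<Rightarrow> 'v::finite \<Rightarrow> 'a::idom) \<Rightarrow> 'p topology" where
  "zariski c = topology (\<lambda>U. \<exists>S. U = - zero_locus c S)"

lemma mpoly_eval_superset:
  assumes "finite M" "Poly_Mapping.keys p \<subseteq> M"
  shows "mpoly_eval p c =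
    (\<Sum>m\<in>M. Poly_Mapping.lookup p m * (\<Prod>v\<in>UNIV. c v ^ Poly_Mapping.lookup m v))"
  unfolding mpoly_eval_def
  by (rule sum.mono_neutral_left) (use assms in \<open>auto simp: in_keys_iff\<close>)

lemma mpoly_eval_0: "mpoly_eval 0 c = 0"
  by (simp add: mpoly_eval_def)

lemma mpoly_eval_single:
  "mpoly_eval (Poly_Mapping.single m a) c = a * (\<Prod>v\<in>UNIV. c v ^ Poly_Mapping.lookup m v)"
  by (subst mpoly_eval_superset[of "{m}"]) auto

lemma mpoly_eval_1: "mpoly_eval 1 c = 1"
  using mpoly_eval_single[of 0 1 c] by simp

lemma mpoly_eval_add: "mpoly_eval (p + q) c = mpoly_eval p c + mpoly_eval q c"
proof -
  let ?M = "Poly_Mapping.keys p \<union> Poly_Mapping.keys q"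
  have "Poly_Mapping.keys (p + q) \<subseteq> ?M" by (rule Poly_Mapping.keys_add)
  then show ?thesis
    by (simp add: mpoly_eval_superset[of ?M] lookup_add distrib_right sum.distrib)
qed

lemma mpoly_eval_sum: "mpoly_eval (sum f I) c = (\<Sum>i\<in>I. mpoly_eval (f i) c)"
  by (induction I rule: infinite_finite_induct) (auto simp: mpoly_eval_0 mpoly_eval_add)

lemma mpoly_decompose:
  "p = (\<Sum>m\<in>Poly_Mapping.keys p. Poly_Mapping.single m (Poly_Mapping.lookup p m))"
  by (rule poly_mapping_eqI)
    (auto simp: lookup_sum lookup_single when_def sum.delta in_keys_iff)

lemma mpoly_eval_mult: "mpoly_eval (p * q) c = mpoly_eval p c * mpoly_eval q c"
proof -
  have "p * q = (\<Sum>m\<in>Poly_Mapping.keys p. \<Sum>n\<in>Poly_Mapping.keys q.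
      Poly_Mapping.single (m + n) (Poly_Mapping.lookup p m * Poly_Mapping.lookup q n))"
    by (subst mpoly_decompose[of p], subst mpoly_decompose[of q])
      (simp add: sum_product mult_single)
  then have "mpoly_eval (p * q) c = (\<Sum>m\<in>Poly_Mapping.keys p. \<Sum>n\<in>Poly_Mapping.keys q.
      (Poly_Mapping.lookup p m * (\<Prod>v\<in>UNIV. c v ^ Poly_Mapping.lookup m v)) *
      (Poly_Mapping.lookup q n * (\<Prod>v\<in>UNIV. c v ^ Poly_Mapping.lookup n v)))"
    by (simp add: mpoly_eval_sum mpoly_eval_single lookup_add power_add prod.distrib mult_ac)
  then show ?thesis
    by (simp add: mpoly_eval_def sum_product)
qed

lemma zero_locus_Un:
  "zero_locus c S \<union> zero_locus c T = zero_locus c ((\<lambda>(f, g). f * g) ` (S \<times> T))"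
  by (fastforce simp: zero_locus_def mpoly_eval_mult)

lemma zero_locus_Union: "zero_locus c (\<Union>(F ` I)) = (\<Inter>i\<in>I. zero_locus c (F i))"
  by (auto simp: zero_locus_def)

lemma istopology_zariski: "istopology (\<lambda>U. \<exists>S. U = - zero_locus c S)"
  unfolding istopology_def
proof (intro conjI allI impI)
  fix U V assume "\<exists>S. U = - zero_locus c S" "\<exists>S. V = - zero_locus c S"
  then show "\<exists>S. U \<inter> V = - zero_locus c S"
    by (metis Compl_Un zero_locus_Un)
next
  fix \<U> assume "\<forall>U\<in>\<U>. \<exists>S. U = - zero_locus c S"
  then obtain F where "\<forall>U\<in>\<U>. U = - zero_locus c (F U)" by metis
  then have "\<Union>\<U> = - zero_locus c (\<Union>(F ` \<U>))"
    unfolding zero_locus_Union by blast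
  then show "\<exists>S. \<Union>\<U> = - zero_locus c S" by blast
qed

lemma openin_zariski: "openin (zariski c) U \<longleftrightarrow> (\<exists>S. U = - zero_locus c S)"
  by (simp add: zariski_def topology_inverse'[OF istopology_zariski])

lemma topspace_zariski [simp]: "topspace (zariski c) = UNIV"
proof -
  have "UNIV = - zero_locus c {1}" by (auto simp: zero_locus_def mpoly_eval_1)
  then have "openin (zariski c) UNIV" unfolding openin_zariski by blast
  then show ?thesis by (metis openin_subset top.extremum_uniqueI)
qed

lemma closedin_zariski: "closedin (zariski c) V \<longleftrightarrow> (\<exists>S. V = zero_locus c S)"
  by (simp add: closedin_def openin_zariski Compl_eq_Diff_UNIV[symmetric])

definition coords_line :: "'a \<Rightarrow> unit \<Rightarrow> 'a" where
  "coords_line x = (\<lambda>_. x)"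

definition coords_prod :: "'a \<times> ('a^'n) \<Rightarrow> 'n option \<Rightarrow> 'a" where
  "coords_prod P = (\<lambda>i. case i of None \<Rightarrow> fst P | Some j \<Rightarrow> snd P $ j)"

definition coords_mat :: "'a^'n^'n \<Rightarrow> 'n \<times> 'n \<Rightarrow> 'a" where
  "coords_mat M = (\<lambda>(i, j). M $ i $ j)"

definition irreducible_closed :: "'p topology \<Rightarrow> 'p set \<Rightarrow> bool" where
  "irreducible_closed X V \<longleftrightarrow> closedin X V \<and> V \<noteq> {} \<and>
     (\<forall>C D. closedin X C \<longrightarrow> closedin X D \<longrightarrow> V = C \<union> D \<longrightarrow> V = C \<or> V = D)"

text \<open>A matrix in $GL_N(k[x])$ is an \<^const>\<open>invertible\<close> matrix over the ring \<^typ>\<open>'a poly\<close>.\<close>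

definition eval_mat :: "'a::field poly^'n^'n \<Rightarrow> 'a \<Rightarrow> 'a^'n^'n" where
  "eval_mat A x = (\<chi> i j. poly (A $ i $ j) x)"

definition skew_map :: "'a::field poly^'n^'n \<Rightarrow> 'a \<times> ('a^'n) \<Rightarrow> 'a \<times> ('a^'n)" where
  "skew_map A = (\<lambda>(x, y). (x + 1, eval_mat A x *v y))"

definition periodic_subvariety :: "'a::field poly^'n^'n \<Rightarrow> ('a \<times> ('a^'n)) set \<Rightarrow> bool" where
  "periodic_subvariety A V \<longleftrightarrow> irreducible_closed (zariski coords_prod) V \<and>
     (\<exists>n\<ge>1. (skew_map A ^^ n) ` V = V)"

definition period :: "'a::field poly^'n^'n \<Rightarrow> ('a \<times> ('a^'n)) set \<Rightarrow> nat" where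
  "period A V = (LEAST n. n \<ge> 1 \<and> (skew_map A ^^ n) ` V = V)"

text \<open>
  The invariant subvarieties, possibly reducible, that dominate the line under the projection
  to the first factor.
\<close>

definition invariant_dominant :: "'a::field poly^'n^'n \<Rightarrow> ('a \<times> ('a^'n)) set set" where
  "invariant_dominant A =
     {V. closedin (zariski coords_prod) V \<and>
         zariski coords_line closure_of (fst ` V) = UNIV \<and>
         skew_map A ` V = V}"

definition fibre_zero :: "('a::field \<times> ('a^'n)) set \<Rightarrow> ('a^'n) set" where
  "fibre_zero V = {y. (0, y) \<in> V}"

definition GL_stabilizer :: "('a::field^'n) set \<Rightarrow> ('a^'n^'n) set" where
  "GL_stabilizer W = {\<gamma>. invertible \<gamma> \<and> (\<lambda>y. \<gamma> *v y) ` W = W}"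

definition group_of :: "'a::field poly^'n^'n \<Rightarrow> ('a^'n^'n) set" where
  "group_of A = (\<Inter>W\<in>fibre_zero ` invariant_dominant A. GL_stabilizer W)"

text \<open>
  The Zariski topology of $GL_N$, a principal open subset of the affine space of matrices, is the
  subspace topology, so the components can be computed inside the space of matrices.
\<close>

definition group_components :: "'a::field poly^'n^'n \<Rightarrow> ('a^'n^'n) set set" where
  "group_components A = connected_components_of (subtopology (zariski coords_mat) (group_of A))"

end

theory Submission
  imports Defs
begin

text \<open>
  Write \<open>V\<^sub>i = f\<^sup>i(V)\<close> for \<open>V\<close> irreducible of period \<open>m\<close>. A nonempty constructible set that is invariant
  under a map lying over \<open>x \<mapsto> x + m\<close> has infinite projection to the line, which is cofinite by
  Chevalley's theorem and therefore contains a multiple of \<open>m\<close>; by invariance the set meets the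
  fibre over \<open>0\<close>. This is used twice. Applied to \<open>V\<close> minus the other \<open>V\<^sub>i\<close>, it gives a point \<open>w\<close> of the
  fibre with \<open>(0, w) \<in> V\<^sub>i\<close> only if \<open>m\<close> divides \<open>i\<close>. Applied to the closure of the points
  \<open>(m n + 1, A(m n) \<cdots> A(0))\<close>, it gives a matrix \<open>h\<close> in the group that maps the fibre over \<open>0\<close> of \<open>V\<^sub>i\<close>
  into that of \<open>V\<^bsub>i+1\<^esub>\<close>.

  The closed sets \<open>{\<gamma>. (0, \<gamma> w) \<in> V\<^sub>i}\<close>, \<open>i < m\<close>, partition the group. They are disjoint because the
  union of the \<open>f\<^sup>l(V\<^sub>i \<inter> V\<^sub>j)\<close> is an invariant variety: if its fibre contains \<open>\<gamma> w\<close>, it contains \<open>w\<close>,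
  and then \<open>m\<close> divides \<open>l + i\<close> and \<open>l + j\<close> for some \<open>l\<close>. Left multiplication by \<open>h\<close> permutes the connected components
  and moves each part to the next one, so all parts contain the same number of components.
\<close>

section \<open>Hilbert's basis theorem\<close>

definition subring :: "'r::comm_ring_1 set \<Rightarrow> bool" where
  "subring R \<longleftrightarrow> 1 \<in> R \<and> (\<forall>x\<in>R. \<forall>y\<in>R. x - y \<in> R \<and> x * y \<in> R)"

text \<open>The \<open>R\<close>-span of \<open>S\<close>, with \<open>R\<close> a subset of an
  ambient ring rather than a type: in this way Hilbert's theorem can be iterated along a growing
  chain of subrings of one fixed ring.\<close>

inductive_set ideal_gen :: "'r::comm_ring_1 set \<Rightarrow> 'r set \<Rightarrow> 'r set"
  for R S :: "'r set" where
  zero: "0 \<in> ideal_gen R S"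
| add_mult: "x \<in> ideal_gen R S \<Longrightarrow> r \<in> R \<Longrightarrow> s \<in> S \<Longrightarrow> x + r * s \<in> ideal_gen R S"

text \<open>The finitely many generators are taken from the given set \<open>S\<close> itself, so
  that a zero locus is cut out by finitely many of its own equations.\<close>

definition noetherian :: "'r::comm_ring_1 set \<Rightarrow> bool" where
  "noetherian R \<longleftrightarrow> (\<forall>S\<subseteq>R. \<exists>F. finite F \<and> F \<subseteq> S \<and> S \<subseteq> ideal_gen R F)"

definition adjoin :: "'r::comm_ring_1 set \<Rightarrow> 'r \<Rightarrow> 'r set" where
  "adjoin R t = {poly P t | P. \<forall>i. coeff P i \<in> R}"

lemma subring_0: "subring R \<Longrightarrow> 0 \<in> R"
  unfolding subring_def by (metis diff_self)

lemma subring_uminus: "subring R \<Longrightarrow> x \<in> R \<Longrightarrow> - x \<in> R"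
  using subring_0[of R] unfolding subring_def by (metis diff_0)

lemma subring_add: "subring R \<Longrightarrow> x \<in> R \<Longrightarrow> y \<in> R \<Longrightarrow> x + y \<in> R"
  using subring_uminus[of R y] unfolding subring_def by (metis diff_minus_eq_add)

lemma subring_sum: "subring R \<Longrightarrow> (\<And>i. i \<in> I \<Longrightarrow> f i \<in> R) \<Longrightarrow> sum f I \<in> R"
  by (induction I rule: infinite_finite_induct) (auto simp: subring_0 subring_add)

lemma subring_prod: "subring R \<Longrightarrow> (\<And>i. i \<in> I \<Longrightarrow> f i \<in> R) \<Longrightarrow> prod f I \<in> R"
  by (induction I rule: infinite_finite_induct) (auto simp: subring_def)

lemma subring_power: "subring R \<Longrightarrow> x \<in> R \<Longrightarrow> x ^ n \<in> R"
  by (induction n) (auto simp: subring_def)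

lemma ideal_gen_base: "1 \<in> R \<Longrightarrow> s \<in> S \<Longrightarrow> s \<in> ideal_gen R S"
  using ideal_gen.add_mult[OF ideal_gen.zero, of 1 R s S] by simp

lemma ideal_gen_add: "x \<in> ideal_gen R S \<Longrightarrow> y \<in> ideal_gen R S \<Longrightarrow> x + y \<in> ideal_gen R S"
  by (rotate_tac, induction y rule: ideal_gen.induct)
    (auto simp: add.assoc[symmetric] intro: ideal_gen.add_mult)

lemma ideal_gen_mult:
  "subring R \<Longrightarrow> r \<in> R \<Longrightarrow> x \<in> ideal_gen R S \<Longrightarrow> r * x \<in> ideal_gen R S"
proof (rotate_tac 2, induction x rule: ideal_gen.induct)
  case (add_mult x r' s)
  have "r * r' \<in> R" using add_mult unfolding subring_def by blast
  then have "r * x + (r * r') * s \<in> ideal_gen R S"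
    using add_mult by (intro ideal_gen.add_mult) auto
  then show ?case by (simp add: algebra_simps)
qed (simp add: ideal_gen.zero)

lemma ideal_gen_diff:
  assumes "subring R" "x \<in> ideal_gen R S" "y \<in> ideal_gen R S"
  shows "x - y \<in> ideal_gen R S"
  using ideal_gen_add[OF assms(2) ideal_gen_mult[OF assms(1) _ assms(3), of "-1"]]
    subring_uminus[OF assms(1), of 1] assms(1) by (simp add: subring_def)

lemma ideal_gen_mono: "S \<subseteq> T \<Longrightarrow> x \<in> ideal_gen R S \<Longrightarrow> x \<in> ideal_gen R T"
  by (rotate_tac, induction x rule: ideal_gen.induct) (auto intro: ideal_gen.intros)

lemma ideal_gen_finite_support:
  "x \<in> ideal_gen R S \<Longrightarrow> \<exists>T. finite T \<and> T \<subseteq> S \<and> x \<in> ideal_gen R T"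
proof (induction x rule: ideal_gen.induct)
  case zero
  then show ?case by (blast intro: ideal_gen.zero)
next
  case (add_mult x r s)
  then obtain T where T: "finite T" "T \<subseteq> S" "x \<in> ideal_gen R T" by blast
  then have "x + r * s \<in> ideal_gen R (insert s T)"
    using add_mult by (intro ideal_gen.add_mult) (auto intro: ideal_gen_mono[of T "insert s T"])
  then show ?case using T add_mult by (intro exI[of _ "insert s T"]) auto
qed

lemma subring_adjoin:
  assumes R: "subring R"
  shows "subring (adjoin R t)" "R \<subseteq> adjoin R t" "t \<in> adjoin R t"
proof -
  have "1 \<in> adjoin R t" unfolding adjoin_def using subring_0[OF R] R
    by (intro CollectI exI[of _ "1"]) (auto simp: subring_def coeff_1)
  moreover have "poly P t - poly Q t \<in> adjoin R t \<and> poly P t * poly Q t \<in> adjoin R t"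
    if "\<forall>i. coeff P i \<in> R" "\<forall>i. coeff Q i \<in> R" for P Q
  proof -
    have "\<forall>i. coeff (P - Q) i \<in> R" using that R by (simp add: subring_def)
    moreover have "\<forall>i. coeff (P * Q) i \<in> R" unfolding coeff_mult
      using that R by (auto intro!: subring_sum simp: subring_def)
    ultimately show ?thesis
      unfolding adjoin_def poly_diff[symmetric] poly_mult[symmetric] by blast
  qed
  ultimately show "subring (adjoin R t)"
    unfolding subring_def by (force simp: adjoin_def)
  show "R \<subseteq> adjoin R t"
  proof
    fix r assume "r \<in> R"
    then show "r \<in> adjoin R t" unfolding adjoin_def using subring_0[OF R]
      by (intro CollectI exI[of _ "[:r:]"]) (auto simp: coeff_pCons split: nat.split)
  qed
  show "t \<in> adjoin R t" unfolding adjoin_def using subring_0[OF R] R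
    by (intro CollectI exI[of _ "[:0,1:]"]) (auto simp: coeff_pCons subring_def split: nat.split)
qed

text \<open>Leading coefficients in formal degree \<open>d\<close>; a representing polynomial need not be unique.\<close>

definition lead_coeffs :: "'r::comm_ring_1 set \<Rightarrow> 'r \<Rightarrow> 'r set \<Rightarrow> nat \<Rightarrow> 'r set" where
  "lead_coeffs R t S d = {coeff Q d | Q. (\<forall>i. coeff Q i \<in> R) \<and> degree Q \<le> d \<and>
     poly Q t \<in> ideal_gen (adjoin R t) S}"

lemma lead_coeffs_mono_set: "S \<subseteq> T \<Longrightarrow> lead_coeffs R t S d \<subseteq> lead_coeffs R t T d"
  unfolding lead_coeffs_def using ideal_gen_mono by blast

text \<open>Multiplication by \<open>t\<close> lifts a representing polynomial to the next formal
  degree without changing its top coefficient.\<close>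

lemma lead_coeffs_mono:
  assumes R: "subring R" and "d \<le> e"
  shows "lead_coeffs R t S d \<subseteq> lead_coeffs R t S e"
  using \<open>d \<le> e\<close>
proof (induction e rule: dec_induct)
  case (step e)
  have "lead_coeffs R t S e \<subseteq> lead_coeffs R t S (Suc e)"
  proof
    fix a assume "a \<in> lead_coeffs R t S e"
    then obtain Q where Q: "a = coeff Q e" "\<forall>i. coeff Q i \<in> R" "degree Q \<le> e"
      "poly Q t \<in> ideal_gen (adjoin R t) S" unfolding lead_coeffs_def by blast
    have "poly (pCons 0 Q) t \<in> ideal_gen (adjoin R t) S"
      using ideal_gen_mult[OF subring_adjoin(1)[OF R] subring_adjoin(3)[OF R] Q(4)] by simp
    then show "a \<in> lead_coeffs R t S (Suc e)"
      unfolding lead_coeffs_def using Q subring_0[OF R]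
      by (intro CollectI exI[of _ "pCons 0 Q"]) (auto simp: coeff_pCons split: nat.split)
  qed
  with step show ?case by blast
qed simp

lemma ideal_gen_lead_coeffs:
  assumes R: "subring R" and F: "F \<subseteq> lead_coeffs R t S d"
  shows "ideal_gen R F \<subseteq> lead_coeffs R t S d"
proof
  fix x assume "x \<in> ideal_gen R F"
  then show "x \<in> lead_coeffs R t S d"
  proof (induction x rule: ideal_gen.induct)
    case zero
    show ?case unfolding lead_coeffs_def using subring_0[OF R]
      by (intro CollectI exI[of _ 0]) (auto intro: ideal_gen.zero)
  next
    case (add_mult x r s)
    then obtain P Q where P: "x = coeff P d" "\<forall>i. coeff P i \<in> R" "degree P \<le> d"
        "poly P t \<in> ideal_gen (adjoin R t) S"
      and Q: "s = coeff Q d" "\<forall>i. coeff Q i \<in> R" "degree Q \<le> d"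
        "poly Q t \<in> ideal_gen (adjoin R t) S"
      using F unfolding lead_coeffs_def by blast
    have "r * poly Q t \<in> ideal_gen (adjoin R t) S"
      using ideal_gen_mult[OF subring_adjoin(1)[OF R] _ Q(4)] subring_adjoin(2)[OF R] add_mult
      by blast
    then have "poly (P + smult r Q) t \<in> ideal_gen (adjoin R t) S"
      using ideal_gen_add[OF P(4)] by simp
    moreover have "degree (P + smult r Q) \<le> d"
      using P(3) Q(3) degree_smult_le[of r Q] by (intro degree_add_le) auto
    moreover have "\<forall>i. coeff (P + smult r Q) i \<in> R"
      using P(2) Q(2) R add_mult by (auto intro!: subring_add simp: subring_def)
    ultimately show ?case
      unfolding lead_coeffs_def using P(1) Q(1) by (intro CollectI exI[of _ "P + smult r Q"]) auto
  qed
qed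

text \<open>Hilbert's argument: the ideals of leading coefficients grow with the degree and stop
  growing at some \<open>D\<close>; finitely many elements of \<open>S\<close> account for all
  degrees up to \<open>D\<close>, hence for all degrees, and cancelling leading terms then expresses
  every element of \<open>S\<close> through them.\<close>

lemma noetherian_adjoin:
  assumes R: "subring R" and N: "noetherian R"
  shows "noetherian (adjoin R t)"
  unfolding noetherian_def
proof (intro allI impI)
  let ?L = "lead_coeffs R t" and ?J = "ideal_gen (adjoin R t)"
  fix S assume S: "S \<subseteq> adjoin R t"
  have LR: "?L S d \<subseteq> R" for d unfolding lead_coeffs_def by auto
  \<comment> \<open>The ideal of leading coefficients in degree \<open>d\<close> has a finite
    generating set, and each of its generators is witnessed by a combination of finitely many
    elements of \<open>S\<close>.\<close>
  have "\<exists>T. finite T \<and> T \<subseteq> S \<and> ?L S d \<subseteq> ?L T d" for d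
  proof -
    obtain F where F: "finite F" "F \<subseteq> ?L S d" "?L S d \<subseteq> ideal_gen R F"
      using N LR unfolding noetherian_def by meson
    have "\<exists>T. finite T \<and> T \<subseteq> S \<and> a \<in> ?L T d" if "a \<in> F" for a
      using F(2) that ideal_gen_finite_support unfolding lead_coeffs_def
      by (smt (verit, best) mem_Collect_eq subset_iff)
    then obtain T where T: "\<And>a. a \<in> F \<Longrightarrow> finite (T a) \<and> T a \<subseteq> S \<and> a \<in> ?L (T a) d" by metis
    have "F \<subseteq> ?L (\<Union>(T ` F)) d"
      using T lead_coeffs_mono_set by (smt (verit, best) UN_upper subset_iff)
    then have "?L S d \<subseteq> ?L (\<Union>(T ` F)) d" using F ideal_gen_lead_coeffs[OF R] by blast
    then show ?thesis using F T by (intro exI[of _ "\<Union>(T ` F)"]) blast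
  qed
  then obtain T where T: "\<And>d. finite (T d) \<and> T d \<subseteq> S \<and> ?L S d \<subseteq> ?L (T d) d" by metis
  \<comment> \<open>The union over all degrees is generated by finitely many elements, and these
    appear together in one degree, since the ideals increase.\<close>
  obtain F where F: "finite F" "F \<subseteq> (\<Union>d. ?L S d)" "(\<Union>d. ?L S d) \<subseteq> ideal_gen R F"
    using N LR unfolding noetherian_def by (meson UN_least)
  have "\<exists>D. F \<subseteq> ?L S D"
    using F(1,2)
  proof (induction F)
    case (insert a F)
    then obtain D d where "F \<subseteq> ?L S D" "a \<in> ?L S d" by auto
    then have "insert a F \<subseteq> ?L S (max D d)"
      using lead_coeffs_mono[OF R, of D "max D d" t S] lead_coeffs_mono[OF R, of d "max D d" t S]
      by auto
    then show ?case by blast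
  qed simp
  then obtain D where "F \<subseteq> ?L S D" by blast
  then have D: "?L S n \<subseteq> ?L S D" for n
    using F(3) ideal_gen_lead_coeffs[OF R] by blast
  define U where "U = (\<Union>d\<le>D. T d)"
  have U: "finite U" "U \<subseteq> S" using T unfolding U_def by auto
  have LU: "?L S n \<subseteq> ?L U n" for n
  proof (cases "n \<le> D")
    case True
    then show ?thesis using T[of n] lead_coeffs_mono_set[of "T n" U R t n] unfolding U_def by blast
  next
    case False
    then have "?L U D \<subseteq> ?L U n" by (intro lead_coeffs_mono[OF R]) auto
    moreover have "?L S D \<subseteq> ?L U D"
      using T[of D] lead_coeffs_mono_set[of "T D" U R t D] unfolding U_def by blast
    ultimately show ?thesis using D by blast
  qed
  \<comment> \<open>The induction runs over a degree bound \<open>n\<close> and not over the exact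
    degree, because the coefficient in degree \<open>n\<close> may vanish.\<close>
  have main: "poly P t \<in> ?J U"
    if "degree P \<le> n" "\<forall>i. coeff P i \<in> R" "poly P t \<in> ?J S" for P n
    using that
  proof (induction n arbitrary: P)
    case 0
    then have "coeff P 0 \<in> ?L S 0" unfolding lead_coeffs_def by blast
    then obtain Q where Q: "coeff P 0 = coeff Q 0" "degree Q \<le> 0" "poly Q t \<in> ?J U"
      using LU unfolding lead_coeffs_def by blast
    then show ?case using 0 by (auto elim!: degree_eq_zeroE)
  next
    case (Suc n)
    then have "coeff P (Suc n) \<in> ?L S (Suc n)" unfolding lead_coeffs_def by blast
    then obtain Q where Q: "coeff P (Suc n) = coeff Q (Suc n)" "degree Q \<le> Suc n"
      "poly Q t \<in> ?J U" "\<forall>i. coeff Q i \<in> R" using LU unfolding lead_coeffs_def by blast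
    have "degree (P - Q) \<le> n"
    proof (rule degree_le, intro allI impI)
      fix i assume "n < i"
      then show "coeff (P - Q) i = 0"
        using Q(1,2) Suc.prems(1) by (cases "i = Suc n") (auto simp: coeff_eq_0)
    qed
    moreover have "\<forall>i. coeff (P - Q) i \<in> R" using Suc.prems Q R by (simp add: subring_def)
    moreover have "poly (P - Q) t \<in> ?J S"
      using Suc.prems(3) ideal_gen_mono[OF U(2) Q(3)] subring_adjoin(1)[OF R]
      by (simp add: ideal_gen_diff)
    ultimately have "poly (P - Q) t \<in> ?J U" by (rule Suc.IH)
    from ideal_gen_add[OF this Q(3)] show ?case by simp
  qed
  have "S \<subseteq> ?J U"
  proof
    fix s assume s: "s \<in> S"
    then obtain P where "s = poly P t" "\<forall>i. coeff P i \<in> R" using S unfolding adjoin_def by blast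
    moreover have "s \<in> ?J S"
      using s subring_adjoin(1)[OF R] by (intro ideal_gen_base) (auto simp: subring_def)
    ultimately show "s \<in> ?J U" using main[of P "degree P"] by blast
  qed
  with U show "\<exists>F. finite F \<and> F \<subseteq> S \<and> S \<subseteq> ?J F" by blast
qed

section \<open>Multivariate polynomials as iterated ring adjunctions\<close>

definition mpoly_const :: "'a \<Rightarrow> ('v, 'a::comm_ring_1) mpoly" where
  "mpoly_const a = Poly_Mapping.single 0 a"

definition mpoly_var :: "'v \<Rightarrow> ('v, 'a::comm_ring_1) mpoly" where
  "mpoly_var v = Poly_Mapping.single (Poly_Mapping.single v 1) 1"

lemma mpoly_eval_const [simp]: "mpoly_eval (mpoly_const a) c = a"
  by (simp add: mpoly_const_def mpoly_eval_single)

lemma mpoly_eval_var [simp]: "mpoly_eval (mpoly_var v) c = c v"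
proof -
  have "(\<Prod>u\<in>UNIV. c u ^ Poly_Mapping.lookup (Poly_Mapping.single v 1) u) =
      (\<Prod>u\<in>UNIV. if u = v then c v else 1)"
    by (rule prod.cong) (auto simp: lookup_single when_def)
  then show ?thesis by (simp add: mpoly_var_def mpoly_eval_single)
qed

lemma mpoly_monomial:
  "Poly_Mapping.single m a =
    mpoly_const a * (\<Prod>v\<in>UNIV. mpoly_var v ^ Poly_Mapping.lookup m (v::'v::finite))"
proof -
  have *: "mpoly_var v ^ n = Poly_Mapping.single (Poly_Mapping.single v n) (1::'a)" for v :: 'v and n
    by (induction n) (simp_all add: mpoly_var_def mult_single single_add[symmetric] add.commute)
  have "(\<Prod>v\<in>V. mpoly_var v ^ Poly_Mapping.lookup m v) =
      Poly_Mapping.single (\<Sum>v\<in>V. Poly_Mapping.single v (Poly_Mapping.lookup m v)) (1::'a)" for V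
    by (induction V rule: infinite_finite_induct) (simp_all add: * mult_single)
  moreover have "(\<Sum>v\<in>UNIV. Poly_Mapping.single v (Poly_Mapping.lookup m v)) = m"
    by (rule poly_mapping_eqI) (simp add: lookup_sum lookup_single when_def)
  ultimately show ?thesis by (simp add: mpoly_const_def mult_single)
qed

lemma subring_eq_UNIV:
  fixes R :: "('v::finite, 'a::comm_ring_1) mpoly set"
  assumes R: "subring R" and "\<And>a. mpoly_const a \<in> R" "\<And>v. mpoly_var v \<in> R"
  shows "R = UNIV"
proof -
  have "p \<in> R" for p
    by (subst mpoly_decompose, unfold mpoly_monomial, intro subring_sum[OF R])
      (use R in \<open>simp add: subring_def assms subring_prod[OF R] subring_power[OF R]\<close>)
  then show ?thesis by blast
qed

text \<open>The elements with \<open>P\<close> form a subring containing the constants and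
  variables. Differences stand in for sums because \<open>subring\<close> is stated with
  them.\<close>

lemma mpoly_induct [case_names const var diff mult]:
  fixes p :: "('v::finite, 'a::comm_ring_1) mpoly"
  assumes "\<And>a. P (mpoly_const a)" "\<And>v. P (mpoly_var v)"
    "\<And>p q. P p \<Longrightarrow> P q \<Longrightarrow> P (p - q)" "\<And>p q. P p \<Longrightarrow> P q \<Longrightarrow> P (p * q)"
  shows "P p"
proof -
  have "mpoly_const 1 = (1 :: ('v, 'a) mpoly)" by (simp add: mpoly_const_def)
  then have "subring (Collect P)" using assms(1)[of 1] assms(3,4) by (simp add: subring_def)
  then have "Collect P = UNIV" by (rule subring_eq_UNIV) (use assms in auto)
  then show ?thesis by blast
qed

lemma mpoly_eval_diff: "mpoly_eval (p - q) c = mpoly_eval p c - mpoly_eval q c"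
  using mpoly_eval_add[of "p - q" q c] by simp

text \<open>Start from the constants, which form a field, and adjoin the finitely many variables one
  after another.\<close>

lemma noetherian_mpoly: "noetherian (UNIV :: ('v::finite, 'a::field) mpoly set)"
proof -
  have "\<exists>R. subring R \<and> noetherian R \<and> range mpoly_const \<subseteq> R \<and>
      (mpoly_var :: 'v \<Rightarrow> ('v, 'a) mpoly) ` V \<subseteq> R" if "finite V" for V
    using that
  proof (induction V)
    case empty
    let ?R = "range mpoly_const :: ('v, 'a) mpoly set"
    have "1 = mpoly_const 1" "mpoly_const a - mpoly_const b = mpoly_const (a - b)"
      "mpoly_const a * mpoly_const b = mpoly_const (a * b)" for a b :: 'a
      by (auto simp: mpoly_const_def single_diff mult_single)
    then have R: "subring ?R" unfolding subring_def by (metis (no_types, lifting) imageE rangeI)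
    have "\<exists>F. finite F \<and> F \<subseteq> S \<and> S \<subseteq> ideal_gen ?R F" if "S \<subseteq> ?R" for S
    proof (cases "S \<subseteq> {0}")
      case True
      then show ?thesis by (intro exI[of _ "{}"]) (auto intro: ideal_gen.zero)
    next
      case False
      then obtain s where "s \<in> S" "s \<noteq> 0" by blast
      moreover from this that obtain a where "s = mpoly_const a" by blast
      ultimately have a: "mpoly_const a \<in> S" "mpoly_const a \<noteq> (0 :: ('v, 'a) mpoly)" by auto
      then have "a \<noteq> 0" by (auto simp: mpoly_const_def)
      \<comment> \<open>A nonzero constant is a unit, so it alone generates everything.\<close>
      have "mpoly_const b \<in> ideal_gen ?R {mpoly_const a}" for b
      proof -
        have "(mpoly_const b :: ('v, 'a) mpoly) = 0 + mpoly_const (b / a) * mpoly_const a"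
          using \<open>a \<noteq> 0\<close> by (simp add: mpoly_const_def mult_single)
        then show ?thesis by (metis ideal_gen.intros rangeI singletonI)
      qed
      then have "S \<subseteq> ideal_gen ?R {mpoly_const a}" using that by blast
      then show ?thesis using a by blast
    qed
    then have "noetherian ?R" unfolding noetherian_def by blast
    with R show ?case by blast
  next
    case (insert v V)
    then obtain R where R: "subring R" "noetherian R" "range mpoly_const \<subseteq> R"
      "(mpoly_var :: 'v \<Rightarrow> ('v, 'a) mpoly) ` V \<subseteq> R" by blast
    then show ?case
      using subring_adjoin[OF R(1), of "mpoly_var v"] noetherian_adjoin[OF R(1,2), of "mpoly_var v"]
      by (intro exI[of _ "adjoin R (mpoly_var v)"]) auto
  qed
  then obtain R where R: "subring R" "noetherian R" "range mpoly_const \<subseteq> R"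
    "range (mpoly_var :: 'v \<Rightarrow> ('v, 'a) mpoly) \<subseteq> R" by (metis finite)
  then have "R = UNIV" by (intro subring_eq_UNIV) auto
  with R show ?thesis by simp
qed

text \<open>Common zeros of a finite generating subset are zeros of the whole ideal, hence of
  \<open>S\<close>.\<close>

lemma zero_locus_finite:
  fixes c :: "'p \<Rightarrow> 'v::finite \<Rightarrow> 'a::field"
  shows "\<exists>F. finite F \<and> F \<subseteq> S \<and> zero_locus c F = zero_locus c S"
proof -
  obtain F where F: "finite F" "F \<subseteq> S" "S \<subseteq> ideal_gen UNIV F"
    using noetherian_mpoly[where 'a = 'a and 'v = 'v] unfolding noetherian_def by blast
  have "mpoly_eval f (c P) = 0" if "f \<in> ideal_gen UNIV F" "P \<in> zero_locus c F" for f P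
    using that
    by (induction f rule: ideal_gen.induct)
      (auto simp: mpoly_eval_0 mpoly_eval_add mpoly_eval_mult zero_locus_def)
  then have "zero_locus c F \<subseteq> zero_locus c S" using F(3) unfolding zero_locus_def by blast
  moreover have "zero_locus c S \<subseteq> zero_locus c F" using F(2) unfolding zero_locus_def by blast
  ultimately show ?thesis using F by blast
qed

section \<open>Elimination of a variable\<close>

text \<open>An \<open>mpoly poly\<close> is read as a family of univariate polynomials with
  parameters; \<open>spec \<sigma>\<close> picks the member at the parameter point
  \<open>\<sigma>\<close>, whose degree may be smaller.\<close>

definition spec :: "('v::finite \<Rightarrow> 'a) \<Rightarrow> ('v, 'a::comm_ring_1) mpoly poly \<Rightarrow> 'a poly" where
  "spec \<sigma> = map_poly (\<lambda>r. mpoly_eval r \<sigma>)"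

lemma coeff_spec [simp]: "coeff (spec \<sigma> P) i = mpoly_eval (coeff P i) \<sigma>"
  by (simp add: spec_def coeff_map_poly mpoly_eval_0)

lemma spec_0 [simp]: "spec \<sigma> 0 = 0" by (simp add: spec_def)

lemma spec_diff: "spec \<sigma> (P - Q) = spec \<sigma> P - spec \<sigma> Q"
  by (rule poly_eqI) (simp add: mpoly_eval_diff)

lemma spec_add: "spec \<sigma> (P + Q) = spec \<sigma> P + spec \<sigma> Q"
  by (rule poly_eqI) (simp add: mpoly_eval_add)

lemma spec_mult: "spec \<sigma> (P * Q) = spec \<sigma> P * spec \<sigma> Q"
  by (rule poly_eqI) (simp add: coeff_mult mpoly_eval_sum mpoly_eval_mult)

lemma spec_smult: "spec \<sigma> (smult r P) = smult (mpoly_eval r \<sigma>) (spec \<sigma> P)"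
  by (rule poly_eqI) (simp add: mpoly_eval_mult)

lemma spec_monom: "spec \<sigma> (monom r n) = monom (mpoly_eval r \<sigma>) n"
  by (rule poly_eqI) (simp add: coeff_monom mpoly_eval_0)

lemma mpoly_eval_power: "mpoly_eval (p ^ n) c = mpoly_eval p c ^ n"
  by (induction n) (simp_all add: mpoly_eval_1 mpoly_eval_mult)

lemma spec_power: "spec \<sigma> (P ^ n) = spec \<sigma> P ^ n"
  by (induction n) (simp_all add: spec_mult, simp add: spec_def mpoly_eval_1)

lemma degree_spec_le: "degree (spec \<sigma> P) \<le> degree P"
  by (rule degree_le) (auto simp: coeff_eq_0 mpoly_eval_0)

lemma degree_spec:
  assumes "mpoly_eval (lead_coeff P) \<sigma> \<noteq> 0"
  shows "degree (spec \<sigma> P) = degree P"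
  using assms degree_spec_le[of \<sigma> P] le_degree[of "spec \<sigma> P" "degree P"] by simp

section \<open>Constructible sets and parametric systems in one unknown\<close>

inductive_set constructible :: "('v::finite \<Rightarrow> 'a::comm_ring_1) set set" where
  zeros: "{\<sigma>. mpoly_eval p \<sigma> = 0} \<in> constructible"
| compl: "S \<in> constructible \<Longrightarrow> - S \<in> constructible"
| inter: "S \<in> constructible \<Longrightarrow> T \<in> constructible \<Longrightarrow> S \<inter> T \<in> constructible"

lemma constructible_union:
  "S \<in> constructible \<Longrightarrow> T \<in> constructible \<Longrightarrow> S \<union> T \<in> constructible"
  using constructible.compl[OF constructible.inter[OF constructible.compl constructible.compl]]
  by (metis Compl_Un double_complement)

lemma constructible_empty: "{} \<in> constructible"
  using constructible.zeros[of 1] by (simp add: mpoly_eval_1)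

lemma constructible_Union:
  "finite F \<Longrightarrow> F \<subseteq> constructible \<Longrightarrow> \<Union>F \<in> constructible"
  by (induction F rule: finite_induct) (auto simp: constructible_empty constructible_union)

lemma constructible_nonzeros: "{\<sigma>. mpoly_eval p \<sigma> \<noteq> 0} \<in> constructible"
  using constructible.compl[OF constructible.zeros[of p]] by (simp add: Compl_eq)

lemma constructible_spec_nonzero: "{\<sigma>. spec \<sigma> P \<noteq> 0} \<in> constructible"
proof -
  have "{\<sigma>. spec \<sigma> P \<noteq> 0} = (\<Union>i\<le>degree P. {\<sigma>. mpoly_eval (coeff P i) \<sigma> \<noteq> 0})"
  proof -
    have "spec \<sigma> P \<noteq> 0 \<longleftrightarrow> (\<exists>i\<le>degree P. mpoly_eval (coeff P i) \<sigma> \<noteq> 0)" for \<sigma>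
      by (metis coeff_0 coeff_spec degree_spec_le leading_coeff_0_iff)
    then show ?thesis by auto
  qed
  also have "\<dots> \<in> constructible"
    by (intro constructible_Union) (auto simp: constructible_nonzeros)
  finally show ?thesis .
qed

text \<open>A one-variable Nullstellensatz: each linear factor of \<open>p\<close>, counted with
  multiplicity, divides \<open>q\<close>, and there are at most \<open>d\<close> of them.\<close>

lemma dvd_power_if_roots_subset:
  fixes p q :: "'a::alg_closed_field poly"
  assumes "p \<noteq> 0" "\<And>y. poly p y = 0 \<Longrightarrow> poly q y = 0" "degree p \<le> d"
  shows "p dvd q ^ d"
  using assms
proof (induction d arbitrary: p)
  case 0
  then show ?case by (auto simp: is_unit_iff_degree)
next
  case (Suc d)
  show ?case
  proof (cases "degree p = 0")
    case True
    then have "p dvd 1" using Suc.prems(1) by (simp add: is_unit_iff_degree)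
    then show ?thesis using dvd_trans one_dvd by blast
  next
    case False
    then obtain a where a: "poly p a = 0" using alg_closed_imp_poly_has_root by blast
    then obtain r where r: "p = [:- a, 1:] * r" using poly_eq_0_iff_dvd by (metis dvdE)
    have "r \<noteq> 0" using r Suc.prems(1) by auto
    then have "degree p = Suc (degree r)" unfolding r by (subst degree_mult_eq) auto
    then have "r dvd q ^ d"
      using Suc.prems \<open>r \<noteq> 0\<close> unfolding r by (intro Suc.IH) auto
    moreover have "[:- a, 1:] dvd q" using Suc.prems(2)[OF a] by (simp add: poly_eq_0_iff_dvd)
    ultimately show ?thesis unfolding r power_Suc by (blast intro: mult_dvd_mono)
  qed
qed

text \<open>The projection of a locally closed set along one coordinate. A single inequation
  suffices, since several can be multiplied into one.\<close>

definition solvable ::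
  "('v::finite, 'a::comm_ring_1) mpoly poly list \<Rightarrow> ('v, 'a) mpoly poly \<Rightarrow> ('v \<Rightarrow> 'a) set" where
  "solvable Ps q = {\<sigma>. \<exists>y. (\<forall>P\<in>set Ps. poly (spec \<sigma> P) y = 0) \<and> poly (spec \<sigma> q) y \<noteq> 0}"

text \<open>Where the leading coefficient of \<open>P\<close> does not vanish, all roots of \<open>P\<close> are roots of \<open>q\<close> iff
  \<open>P\<close> divides \<open>q ^ degree P\<close>, which is read off a pseudo-remainder.\<close>

lemma solvable_single:
  fixes P q :: "('v::finite, 'a::alg_closed_field) mpoly poly"
  assumes "P \<noteq> 0"
  shows "{\<sigma>. mpoly_eval (lead_coeff P) \<sigma> \<noteq> 0} \<inter> solvable [P] q \<in> constructible"
proof -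
  define d where "d = degree P"
  obtain s r where sr: "pseudo_divmod (q ^ d) P = (s, r)" by fastforce
  \<comment> \<open>The power of the leading coefficient by which pseudo-division multiplies the
    dividend; it is a unit wherever that coefficient does not vanish.\<close>
  define k where "k = Suc (degree (q ^ d)) - degree P"
  have eq: "smult (lead_coeff P ^ k) (q ^ d) = P * s + r" and deg: "r = 0 \<or> degree r < d"
    using pseudo_divmod[OF assms sr] unfolding k_def d_def by auto
  have "(\<exists>y. poly (spec \<sigma> P) y = 0 \<and> poly (spec \<sigma> q) y \<noteq> 0) \<longleftrightarrow> spec \<sigma> r \<noteq> 0"
    if lc: "mpoly_eval (lead_coeff P) \<sigma> \<noteq> 0" for \<sigma>
  proof -
    let ?c = "mpoly_eval (lead_coeff P) \<sigma> ^ k"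
    have c: "?c \<noteq> 0" using lc by simp
    have eq': "smult ?c (spec \<sigma> q ^ d) = spec \<sigma> P * spec \<sigma> s + spec \<sigma> r"
      using arg_cong[OF eq, of "spec \<sigma>"]
      by (simp add: spec_smult spec_power spec_mult spec_add mpoly_eval_power)
    have P: "degree (spec \<sigma> P) = d" "spec \<sigma> P \<noteq> 0"
      using degree_spec[OF lc] lc coeff_spec[of \<sigma> P "degree P"] unfolding d_def
      by (simp, metis coeff_0)
    show ?thesis
    proof
      assume "\<exists>y. poly (spec \<sigma> P) y = 0 \<and> poly (spec \<sigma> q) y \<noteq> 0"
      then obtain y where "poly (spec \<sigma> P) y = 0" "poly (spec \<sigma> q) y \<noteq> 0" by blast
      then have "poly (spec \<sigma> r) y \<noteq> 0"
        using arg_cong[OF eq', of "\<lambda>p. poly p y"] c by (auto simp: poly_power)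
      then show "spec \<sigma> r \<noteq> 0" by auto
    next
      assume r: "spec \<sigma> r \<noteq> 0"
      show "\<exists>y. poly (spec \<sigma> P) y = 0 \<and> poly (spec \<sigma> q) y \<noteq> 0"
      proof (rule ccontr)
        assume "\<nexists>y. poly (spec \<sigma> P) y = 0 \<and> poly (spec \<sigma> q) y \<noteq> 0"
        then have "spec \<sigma> P dvd spec \<sigma> q ^ d"
          using P by (intro dvd_power_if_roots_subset) auto
        then have "spec \<sigma> P dvd spec \<sigma> r"
          using eq' by (metis dvd_add_right_iff dvd_smult dvd_triv_left)
        then have "d \<le> degree (spec \<sigma> r)" using dvd_imp_degree_le[OF _ r] P(1) by metis
        also have "\<dots> \<le> degree r" by (rule degree_spec_le)
        also have "\<dots> < d" using deg r by auto
        finally show False by simp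
      qed
    qed
  qed
  then have "{\<sigma>. mpoly_eval (lead_coeff P) \<sigma> \<noteq> 0} \<inter> solvable [P] q =
      {\<sigma>. mpoly_eval (lead_coeff P) \<sigma> \<noteq> 0} \<inter> {\<sigma>. spec \<sigma> r \<noteq> 0}"
    unfolding solvable_def by auto
  then show ?thesis
    by (simp add: constructible.inter constructible_nonzeros constructible_spec_nonzero)
qed

text \<open>Euclid's algorithm with a case split on leading coefficients: where the leading
  coefficient of a polynomial vanishes, its top term is deleted; where it does not, it reduces a
  polynomial of at least the same degree. The recursion ends with at most one equation.\<close>

lemma solvable_constructible:
  fixes q :: "('v::finite, 'a::{alg_closed_field, field_char_0}) mpoly poly"
  shows "solvable Ps q \<in> constructible"
\<comment> \<open>A zero polynomial weighs 1 and a nonzero one its degree plus 2, so the weight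
  drops both when a zero entry is discarded and when a constant becomes zero.\<close>
proof (induction "\<Sum>P\<leftarrow>Ps. if P = 0 then 1 else degree P + 2" arbitrary: Ps rule: less_induct)
  case less
  let ?lc = "\<lambda>P \<sigma>. mpoly_eval (lead_coeff P) \<sigma>" and ?sz = "\<lambda>P. if P = 0 then 1 else degree P + 2"
  \<comment> \<open>On the locus where the leading coefficient of \<open>P\<close> vanishes,
    \<open>P\<close> may be replaced by its tail, which has smaller weight; the other locus is left
    to the assumption \<open>lc\<close>.\<close>
  have drop: "solvable (P # Qs) q \<in> constructible"
    if Ps: "mset Ps = mset (P # Qs)" and "P \<noteq> 0" and
      lc: "{\<sigma>. ?lc P \<sigma> \<noteq> 0} \<inter> solvable (P # Qs) q \<in> constructible" for P Qs
  proof -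
    let ?P = "P - monom (lead_coeff P) (degree P)"
    have "coeff ?P i = 0" if "degree P \<le> i" for i
      using that by (cases "i = degree P") (auto simp: coeff_eq_0)
    then have "?P = 0 \<or> degree ?P < degree P"
      by (metis leading_coeff_0_iff not_le)
    moreover have "(\<Sum>P\<leftarrow>Ps. ?sz P) = ?sz P + (\<Sum>P\<leftarrow>Qs. ?sz P)"
      using Ps by (metis (no_types, lifting) list.simps(9) mset_map sum_list.Cons sum_mset_sum_list)
    ultimately have "solvable (?P # Qs) q \<in> constructible"
      using \<open>P \<noteq> 0\<close> by (intro less) auto
    moreover have "spec \<sigma> ?P = spec \<sigma> P" if "?lc P \<sigma> = 0" for \<sigma>
      using that by (simp add: spec_diff spec_monom)
    then have "solvable (P # Qs) q =
      ({\<sigma>. ?lc P \<sigma> = 0} \<inter> solvable (?P # Qs) q) \<union> ({\<sigma>. ?lc P \<sigma> \<noteq> 0} \<inter> solvable (P # Qs) q)"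
      unfolding solvable_def by (auto simp del: coeff_spec)
    ultimately show ?thesis
      using lc constructible_union constructible.inter constructible.zeros by metis
  qed
  \<comment> \<open>The combination \<open>?Q\<close> has the same zeros as \<open>Q\<close> on the
    zero set of \<open>P\<close>, because the factor \<open>lead_coeff P\<close> specialises to a
    nonzero number.\<close>
  have reduce: "{\<sigma>. ?lc P \<sigma> \<noteq> 0} \<inter> solvable (P # Q # Qs) q \<in> constructible"
    if Ps: "mset Ps = mset (P # Q # Qs)" and "P \<noteq> 0" "Q \<noteq> 0" and le: "degree P \<le> degree Q" for P Q Qs
  proof -
    let ?M = "monom (lead_coeff Q) (degree Q - degree P)"
    let ?Q = "smult (lead_coeff P) Q - ?M * P"
    have "coeff ?Q i = 0" if i: "degree Q \<le> i" for i
    proof (cases "i = degree Q")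
      case True
      then show ?thesis using le by (simp add: coeff_monom_mult)
    next
      case False
      then have "degree P < i - (degree Q - degree P)" using i le by linarith
      then show ?thesis using False i le by (simp add: coeff_monom_mult coeff_eq_0)
    qed
    then have "?Q = 0 \<or> degree ?Q < degree Q" by (metis leading_coeff_0_iff not_le)
    moreover have "(\<Sum>P\<leftarrow>Ps. ?sz P) = ?sz P + (?sz Q + (\<Sum>P\<leftarrow>Qs. ?sz P))"
      using Ps by (metis (no_types, lifting) list.simps(9) mset_map sum_list.Cons sum_mset_sum_list)
    ultimately have "solvable (P # ?Q # Qs) q \<in> constructible"
      using \<open>Q \<noteq> 0\<close> by (intro less) auto
    moreover have "poly (spec \<sigma> ?Q) y = 0 \<longleftrightarrow> poly (spec \<sigma> Q) y = 0"
      if "?lc P \<sigma> \<noteq> 0" "poly (spec \<sigma> P) y = 0" for \<sigma> y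
      using that by (simp add: spec_diff spec_mult spec_smult)
    then have "{\<sigma>. ?lc P \<sigma> \<noteq> 0} \<inter> solvable (P # Q # Qs) q =
        {\<sigma>. ?lc P \<sigma> \<noteq> 0} \<inter> solvable (P # ?Q # Qs) q"
      unfolding solvable_def by auto
    ultimately show ?thesis using constructible.inter constructible_nonzeros by metis
  qed
  consider "Ps = []" | Qs where "Ps = 0 # Qs" | P where "Ps = [P]" "P \<noteq> 0"
    | P Qs where "Ps = P # 0 # Qs" | P Q Qs where "Ps = P # Q # Qs" "P \<noteq> 0" "Q \<noteq> 0"
  proof (cases Ps)
    case (Cons P Qs)
    with that show ?thesis by (cases Qs) blast+
  qed (use that in blast)
  then show ?case
  proof cases
    case 1
    \<comment> \<open>Without equations only \<open>q\<close> remains, and a nonzero polynomial over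
      an infinite field has a point where it does not vanish.\<close>
    have "(\<exists>y. poly (spec \<sigma> q) y \<noteq> 0) \<longleftrightarrow> spec \<sigma> q \<noteq> 0" for \<sigma>
      using poly_all_0_iff_0[of "spec \<sigma> q"] by auto
    then show ?thesis using 1 constructible_spec_nonzero[of q] by (simp add: solvable_def)
  next
    case 2
    then have "solvable Ps q = solvable Qs q" by (simp add: solvable_def)
    then show ?thesis using less[of Qs] 2 by simp
  next
    case 3
    then show ?thesis using drop[of P "[]"] solvable_single[of P q] by simp
  next
    case 4
    then have "solvable Ps q = solvable (P # Qs) q" by (simp add: solvable_def)
    then show ?thesis using less[of "P # Qs"] 4 by simp
  next
    case 5
    show ?thesis
    proof (cases "degree P \<le> degree Q")
      case True
      then show ?thesis using drop[of P "Q # Qs"] reduce[of P Q Qs] 5 by simp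
    next
      case False
      have "solvable Ps q = solvable (Q # P # Qs) q" using 5 unfolding solvable_def by auto
      then show ?thesis using drop[of Q "P # Qs"] reduce[of Q P Qs] 5 False
        by (simp add: add_mset_commute)
    qed
  qed
qed

lemma mpoly_univariate:
  fixes p :: "('v::finite, 'a::comm_ring_1) mpoly"
  shows "\<exists>P. \<forall>\<sigma> y. poly (spec \<sigma> P) y = mpoly_eval p (\<sigma>(v := y))"
proof (induction p rule: mpoly_induct)
  case (const a)
  show ?case by (intro exI[of _ "monom (mpoly_const a) 0"]) (simp add: spec_monom poly_monom)
next
  case (var u)
  have "(monom 1 1 :: 'a poly) = spec \<sigma> (monom 1 1)" for \<sigma> :: "'v \<Rightarrow> 'a"
    by (simp add: spec_monom mpoly_eval_1)
  then show ?case
    by (intro exI[of _ "if u = v then monom 1 1 else monom (mpoly_var u) 0"])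
      (auto simp: spec_monom poly_monom mpoly_eval_1)
next
  case (diff p q)
  then show ?case by (metis mpoly_eval_diff poly_diff spec_diff)
next
  case (mult p q)
  then show ?case by (metis mpoly_eval_mult poly_mult spec_mult)
qed

section \<open>Chevalley's theorem for coordinate projections\<close>

definition basic_constructible :: "('v::finite, 'a::comm_ring_1) mpoly list \<Rightarrow> ('v, 'a) mpoly \<Rightarrow> ('v \<Rightarrow> 'a) set" where
  "basic_constructible ps q = {\<sigma>. (\<forall>p\<in>set ps. mpoly_eval p \<sigma> = 0) \<and> mpoly_eval q \<sigma> \<noteq> 0}"

text \<open>Existential quantification commutes with unions but not with complements, so Boolean
  combinations are first turned into disjunctive normal form.\<close>

definition dnf :: "('v::finite \<Rightarrow> 'a::comm_ring_1) set set" where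
  "dnf = {\<Union>F | F. finite F \<and> F \<subseteq> {B. \<exists>ps q. B = basic_constructible ps q}}"

lemma dnf_basic: "basic_constructible ps q \<in> dnf"
  unfolding dnf_def by (intro CollectI exI[of _ "{basic_constructible ps q}"]) auto

lemma dnf_union: "S \<in> dnf \<Longrightarrow> T \<in> dnf \<Longrightarrow> S \<union> T \<in> dnf"
  unfolding dnf_def by (smt (verit) Un_least Union_Un_distrib finite_Un mem_Collect_eq)

lemma dnf_empty: "{} \<in> dnf" unfolding dnf_def by auto

lemma dnf_Union: "finite I \<Longrightarrow> (\<And>i. i \<in> I \<Longrightarrow> S i \<in> dnf) \<Longrightarrow> (\<Union>i\<in>I. S i) \<in> dnf"
  by (induction I rule: finite_induct) (auto simp: dnf_empty dnf_union)

lemma dnf_inter: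
  fixes S T :: "('v::finite \<Rightarrow> 'a::idom) set"
  assumes "S \<in> dnf" "T \<in> dnf"
  shows "S \<inter> T \<in> dnf"
proof -
  obtain F G where F: "S = \<Union>F" "finite F" "F \<subseteq> {B. \<exists>ps q. B = basic_constructible ps q}"
    and G: "T = \<Union>G" "finite G" "G \<subseteq> {B. \<exists>ps q. B = basic_constructible ps q}"
    using assms unfolding dnf_def by blast
  have "S \<inter> T = (\<Union>(A, B)\<in>F \<times> G. A \<inter> B)" using F G by auto
  moreover have "A \<inter> B \<in> dnf" if AB: "A \<in> F" "B \<in> G" for A B
  proof -
    obtain ps q ps' q' where AB': "A = basic_constructible ps q" "B = basic_constructible ps' q'"
      using AB F G by blast
    have "A \<inter> B = basic_constructible (ps @ ps') (q * q')"
      unfolding AB' basic_constructible_def by (auto simp: mpoly_eval_mult)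
    then show ?thesis using dnf_basic by metis
  qed
  ultimately show ?thesis using F G by (auto intro!: dnf_Union)
qed

lemma dnf_compl:
  fixes S :: "('v::finite \<Rightarrow> 'a::idom) set"
  assumes "S \<in> dnf"
  shows "- S \<in> dnf"
proof -
  obtain F where F: "S = \<Union>F" "finite F" "F \<subseteq> {B. \<exists>ps q. B = basic_constructible ps q}"
    using assms unfolding dnf_def by blast
  have U: "(UNIV :: ('v \<Rightarrow> 'a) set) \<in> dnf"
    using dnf_basic[of "[]" 1] by (simp add: basic_constructible_def mpoly_eval_1)
  have "- \<Union>F \<in> dnf" using F(2,3)
  proof (induction F)
    case empty
    then show ?case using U by simp
  next
    case (insert A F)
    then obtain ps q where A: "A = basic_constructible ps q" by auto
    have "- A = (\<Union>p\<in>set ps. basic_constructible [] p) \<union> basic_constructible [q] 1"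
      unfolding A basic_constructible_def by (auto simp: mpoly_eval_1)
    moreover have "\<dots> \<in> dnf" by (intro dnf_union dnf_Union dnf_basic) auto
    ultimately show ?case using insert by (simp add: dnf_inter Compl_Un)
  qed
  then show ?thesis using F by simp
qed

lemma constructible_imp_dnf: "(S :: ('v::finite \<Rightarrow> 'a::idom) set) \<in> constructible \<Longrightarrow> S \<in> dnf"
proof (induction rule: constructible.induct)
  case (zeros p)
  then show ?case using dnf_basic[of "[p]" 1] by (simp add: basic_constructible_def mpoly_eval_1)
qed (auto intro: dnf_inter dnf_compl)

text \<open>In normal form each piece is a system of equations with one inequation in the unknown
  \<open>y\<close>, to which elimination applies.\<close>

lemma constructible_exists_update:
  fixes S :: "('v::finite \<Rightarrow> 'a::{alg_closed_field, field_char_0}) set"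
  assumes "S \<in> constructible"
  shows "{\<sigma>. \<exists>y. \<sigma>(v := y) \<in> S} \<in> constructible"
proof -
  obtain F where F: "S = \<Union>F" "finite F" "F \<subseteq> {B. \<exists>ps q. B = basic_constructible ps q}"
    using constructible_imp_dnf[OF assms] unfolding dnf_def by blast
  have "{\<sigma>. \<exists>y. \<sigma>(v := y) \<in> A} \<in> constructible" if AF: "A \<in> F" for A
  proof -
    obtain ps q where A: "A = basic_constructible ps q" using AF F by blast
    have "\<forall>p. \<exists>P. \<forall>\<sigma> y. poly (spec \<sigma> P) y = mpoly_eval p (\<sigma>(v := y :: 'a))"
      using mpoly_univariate by blast
    from choice[OF this]
    obtain u where u: "\<And>p \<sigma> y. poly (spec \<sigma> (u p)) y = mpoly_eval p (\<sigma>(v := y :: 'a))"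
      by blast
    have "{\<sigma>. \<exists>y. \<sigma>(v := y) \<in> A} = solvable (map u ps) (u q)"
      unfolding A basic_constructible_def solvable_def by (simp add: u)
    then show ?thesis using solvable_constructible by metis
  qed
  moreover have "{\<sigma>. \<exists>y. \<sigma>(v := y) \<in> S} = (\<Union>A\<in>F. {\<sigma>. \<exists>y. \<sigma>(v := y) \<in> A})"
    using F by auto
  ultimately show ?thesis using F by (auto intro!: constructible_Union)
qed

text \<open>The variables in \<open>V\<close> are eliminated one at a time. Points keep their full
  set of coordinates throughout; the result merely no longer depends on those in
  \<open>V\<close>.\<close>

lemma constructible_exists_agree:
  fixes S :: "('v::finite \<Rightarrow> 'a::{alg_closed_field, field_char_0}) set"
  assumes "S \<in> constructible"
  shows "{\<sigma>. \<exists>\<tau>\<in>S. \<forall>u. u \<notin> V \<longrightarrow> \<tau> u = \<sigma> u} \<in> constructible"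
  using finite[of V]
proof (induction V)
  case empty
  have "{\<sigma>. \<exists>\<tau>\<in>S. \<forall>u. \<tau> u = \<sigma> u} = S" by (auto simp: fun_eq_iff[symmetric])
  then show ?case using assms by simp
next
  case (insert v V)
  have "(\<exists>\<tau>\<in>S. \<forall>u. u \<notin> insert v V \<longrightarrow> \<tau> u = \<sigma> u) \<longleftrightarrow>
      (\<exists>y. \<exists>\<tau>\<in>S. \<forall>u. u \<notin> V \<longrightarrow> \<tau> u = (\<sigma>(v := y)) u)" for \<sigma>
  proof
    assume "\<exists>\<tau>\<in>S. \<forall>u. u \<notin> insert v V \<longrightarrow> \<tau> u = \<sigma> u"
    then obtain \<tau> where "\<tau> \<in> S" "\<forall>u. u \<notin> insert v V \<longrightarrow> \<tau> u = \<sigma> u" by blast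
    then show "\<exists>y. \<exists>\<tau>\<in>S. \<forall>u. u \<notin> V \<longrightarrow> \<tau> u = (\<sigma>(v := y)) u"
      by (intro exI[of _ "\<tau> v"] bexI[of _ \<tau>]) auto
  next
    assume "\<exists>y. \<exists>\<tau>\<in>S. \<forall>u. u \<notin> V \<longrightarrow> \<tau> u = (\<sigma>(v := y)) u"
    then obtain y \<tau> where "\<tau> \<in> S" "\<forall>u. u \<notin> V \<longrightarrow> \<tau> u = (\<sigma>(v := y)) u" by blast
    then show "\<exists>\<tau>\<in>S. \<forall>u. u \<notin> insert v V \<longrightarrow> \<tau> u = \<sigma> u"
      by (intro bexI[of _ \<tau>]) auto
  qed
  then have "{\<sigma>. \<exists>\<tau>\<in>S. \<forall>u. u \<notin> insert v V \<longrightarrow> \<tau> u = \<sigma> u} =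
      {\<sigma>. \<exists>y. \<sigma>(v := y) \<in> {\<sigma>. \<exists>\<tau>\<in>S. \<forall>u. u \<notin> V \<longrightarrow> \<tau> u = \<sigma> u}}" by simp
  then show ?case using constructible_exists_update[OF insert(3)] by simp
qed

lemma mpoly_diagonal:
  fixes p :: "('v::finite, 'a::comm_ring_1) mpoly"
  shows "\<exists>P. \<forall>x. poly P x = mpoly_eval p (\<lambda>_. x)"
proof (induction p rule: mpoly_induct)
  case (const a)
  show ?case by (intro exI[of _ "[:a:]"]) simp
next
  case (var v)
  show ?case by (intro exI[of _ "[:0, 1:]"]) simp
qed (metis mpoly_eval_diff poly_diff, metis mpoly_eval_mult poly_mult)

text \<open>On the diagonal every polynomial becomes univariate, so its zeros are finite in number
  or everything; the finite and cofinite sets form a Boolean algebra.\<close>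

lemma constructible_diagonal:
  fixes S :: "('v::finite \<Rightarrow> 'a::idom) set"
  assumes "S \<in> constructible"
  shows "finite {x. (\<lambda>_. x) \<in> S} \<or> finite (- {x. (\<lambda>_. x) \<in> S})"
  using assms
proof induction
  case (zeros p)
  obtain P where P: "\<forall>x. poly P x = mpoly_eval p (\<lambda>_. x)" using mpoly_diagonal by blast
  then have "{x. (\<lambda>_. x) \<in> {\<sigma>. mpoly_eval p \<sigma> = 0}} = {x. poly P x = 0}" by auto
  then show ?case using poly_roots_finite[of P] by (cases "P = 0") auto
next
  case (compl S)
  then show ?case by (auto simp: Collect_neg_eq)
next
  case (inter S T)
  then show ?case by (auto simp: Collect_conj_eq)
qed

text \<open>Once all variables other than \<open>v\<close> are eliminated, membership depends on the
  coordinate \<open>v\<close> only and may be tested at constant points.\<close>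

lemma constructible_projection:
  fixes S :: "('v::finite \<Rightarrow> 'a::{alg_closed_field, field_char_0}) set"
  assumes "S \<in> constructible"
  shows "finite ((\<lambda>\<sigma>. \<sigma> v) ` S) \<or> finite (- ((\<lambda>\<sigma>. \<sigma> v) ` S))"
proof -
  have eq: "(\<lambda>\<sigma>. \<sigma> v) ` S = {x. (\<lambda>_. x) \<in> {\<sigma>. \<exists>\<tau>\<in>S. \<forall>u. u \<notin> - {v} \<longrightarrow> \<tau> u = \<sigma> u}}" by auto
  show ?thesis unfolding eq by (rule constructible_diagonal[OF constructible_exists_agree[OF assms]])
qed

section \<open>Zariski topology\<close>

text \<open>Regular functions as functions on points: a map is then shown to be a morphism
  coordinate by coordinate, using closure rules.\<close>

definition polyfun :: "('p \<Rightarrow> 'v::finite \<Rightarrow> 'a::comm_ring_1) \<Rightarrow> ('p \<Rightarrow> 'a) set" where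
  "polyfun c = range (\<lambda>f P. mpoly_eval f (c P))"

lemma polyfun_const: "(\<lambda>_. a) \<in> polyfun c"
  unfolding polyfun_def by (rule range_eqI[of _ _ "mpoly_const a"]) simp

lemma polyfun_coord: "(\<lambda>P. c P v) \<in> polyfun c"
  unfolding polyfun_def by (rule range_eqI[of _ _ "mpoly_var v"]) simp

lemma polyfun_diff: "f \<in> polyfun c \<Longrightarrow> g \<in> polyfun c \<Longrightarrow> (\<lambda>P. f P - g P) \<in> polyfun c"
  unfolding polyfun_def by (auto simp: mpoly_eval_diff[symmetric])

lemma polyfun_add: "f \<in> polyfun c \<Longrightarrow> g \<in> polyfun c \<Longrightarrow> (\<lambda>P. f P + g P) \<in> polyfun c"
  unfolding polyfun_def by (auto simp: mpoly_eval_add[symmetric])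

lemma polyfun_mult: "f \<in> polyfun c \<Longrightarrow> g \<in> polyfun c \<Longrightarrow> (\<lambda>P. f P * g P) \<in> polyfun c"
  unfolding polyfun_def by (auto simp: mpoly_eval_mult[symmetric])

lemma polyfun_sum: "(\<And>i. i \<in> I \<Longrightarrow> f i \<in> polyfun c) \<Longrightarrow> (\<lambda>P. \<Sum>i\<in>I. f i P) \<in> polyfun c"
  by (induction I rule: infinite_finite_induct) (auto simp: polyfun_const polyfun_add)

lemma polyfun_prod: "(\<And>i. i \<in> I \<Longrightarrow> f i \<in> polyfun c) \<Longrightarrow> (\<lambda>P. \<Prod>i\<in>I. f i P) \<in> polyfun c"
  by (induction I rule: infinite_finite_induct) (auto simp: polyfun_const polyfun_mult)

lemma polyfun_poly: "f \<in> polyfun c \<Longrightarrow> (\<lambda>P. poly p (f P)) \<in> polyfun c"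
  by (induction p) (auto simp: polyfun_const polyfun_mult polyfun_add)

lemma polyfun_compose:
  assumes "\<And>v. (\<lambda>P. c' (\<phi> P) v) \<in> polyfun c"
  shows "(\<lambda>P. mpoly_eval f (c' (\<phi> P))) \<in> polyfun c"
proof (induction f rule: mpoly_induct)
  case (diff p q)
  then show ?case by (simp add: mpoly_eval_diff polyfun_diff)
next
  case (mult p q)
  then show ?case by (simp add: mpoly_eval_mult polyfun_mult)
qed (auto simp: polyfun_const assms)

lemma closedin_vimage:
  assumes \<phi>: "\<And>v. (\<lambda>P. c' (\<phi> P) v) \<in> polyfun c" and V: "closedin (zariski c') V"
  shows "closedin (zariski c) (\<phi> -` V)"
proof -
  obtain S where S: "V = zero_locus c' S" using V unfolding closedin_zariski by blast
  have "\<exists>g. \<forall>P. mpoly_eval f (c' (\<phi> P)) = mpoly_eval g (c P)" for f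
    using polyfun_compose[of c' \<phi> c f, OF \<phi>] unfolding polyfun_def by (auto simp: fun_eq_iff)
  then have "\<forall>f. \<exists>g. \<forall>P. mpoly_eval f (c' (\<phi> P)) = mpoly_eval g (c P)" by blast
  from choice[OF this]
  obtain g where "\<And>f P. mpoly_eval f (c' (\<phi> P)) = mpoly_eval (g f) (c P)" by blast
  then have "\<phi> -` V = zero_locus c (g ` S)" unfolding S zero_locus_def by auto
  then show ?thesis unfolding closedin_zariski by blast
qed

lemma closedin_zeros:
  assumes "f \<in> polyfun c"
  shows "closedin (zariski c) {P. f P = 0}"
proof -
  obtain g where "f = (\<lambda>P. mpoly_eval g (c P))" using assms unfolding polyfun_def by blast
  then have "{P. f P = 0} = zero_locus c {g}" by (simp add: zero_locus_def)
  then show ?thesis unfolding closedin_zariski by blast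
qed

lemma closedin_image:
  assumes "\<And>v. (\<lambda>P. c' (\<psi> P) v) \<in> polyfun c" "\<And>P. \<psi> (\<phi> P) = P" "\<And>P. \<phi> (\<psi> P) = P"
    and "closedin (zariski c') V"
  shows "closedin (zariski c) (\<phi> ` V)"
proof -
  have "\<phi> ` V = \<psi> -` V" 
  proof
    show "\<phi> ` V \<subseteq> \<psi> -` V" using assms(2) by auto
    show "\<psi> -` V \<subseteq> \<phi> ` V"
    proof
      fix P assume "P \<in> \<psi> -` V"
      then show "P \<in> \<phi> ` V" using assms(3)[of P] by (intro image_eqI[of P \<phi> "\<psi> P"]) auto
    qed
  qed
  then show ?thesis using closedin_vimage[of c' \<psi> c V, OF assms(1,4)] by simp
qed

lemma continuous_map_zariski:
  assumes "\<And>v. (\<lambda>P. c' (\<phi> P) v) \<in> polyfun c"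
  shows "continuous_map (zariski c) (zariski c') \<phi>"
  using closedin_vimage[of c' \<phi> c, OF assms] by (auto simp: continuous_map_closedin vimage_def)

section \<open>Noetherian properties of the Zariski topology\<close>

text \<open>All equations of all \<open>C n\<close> together reduce to finitely many, and these
  occur up to some index \<open>N\<close>; after it nothing can shrink.\<close>

lemma zariski_descending_chain:
  fixes c :: "'p \<Rightarrow> 'v::finite \<Rightarrow> 'a::field"
  assumes C: "\<And>n. closedin (zariski c) (C n)" and dec: "\<And>n. C (Suc n) \<subseteq> C n"
  shows "\<exists>n. C (Suc n) = C n"
proof -
  have "\<forall>n. \<exists>S. C n = zero_locus c S" using C unfolding closedin_zariski by blast
  from choice[OF this] obtain S where S: "\<And>n. C n = zero_locus c (S n)" by blast
  obtain F where F: "finite F" "F \<subseteq> (\<Union>n. S n)" "zero_locus c F = zero_locus c (\<Union>n. S n)"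
    using zero_locus_finite[of "\<Union>n. S n" c] by blast
  have "\<exists>N. F \<subseteq> (\<Union>n\<le>N. S n)" using F(1,2)
  proof (induction F)
    case (insert a F)
    then obtain N n where "F \<subseteq> (\<Union>n\<le>N. S n)" "a \<in> S n" by auto
    then have "insert a F \<subseteq> (\<Union>n\<le>max N n. S n)" by (fastforce simp: le_max_iff_disj)
    then show ?case by blast
  qed simp
  then obtain N where N: "F \<subseteq> (\<Union>n\<le>N. S n)" by blast
  have le: "C N \<subseteq> C n" if "n \<le> N" for n using lift_Suc_antimono_le[of C, OF dec that] .
  have "C N \<subseteq> zero_locus c F" using le N unfolding S zero_locus_def by fastforce
  also have "\<dots> = zero_locus c (\<Union>n. S n)" by (rule F(3))
  also have "\<dots> \<subseteq> C (Suc N)" unfolding S zero_locus_def by blast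
  finally show ?thesis using dec[of N] by blast
qed

text \<open>The images under the iterates of \<open>\<phi>\<close> form a descending chain of closed
  sets. Where it becomes stationary, the iterate cancels by injectivity.\<close>

lemma closed_image_subset_imp_eq:
  fixes c :: "'p \<Rightarrow> 'v::finite \<Rightarrow> 'a::field"
  assumes "inj \<phi>" and closed: "\<And>C. closedin (zariski c) C \<Longrightarrow> closedin (zariski c) (\<phi> ` C)"
    and C: "closedin (zariski c) C" "\<phi> ` C \<subseteq> C"
  shows "\<phi> ` C = C"
proof -
  have inj: "inj (\<phi> ^^ n)" for n using assms(1) by (induction n) (auto intro: inj_compose)
  have "closedin (zariski c) ((\<phi> ^^ n) ` C)" for n
  proof (induction n)
    case (Suc n)
    then show ?case using closed[of "(\<phi> ^^ n) ` C"] by (simp add: image_comp)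
  qed (simp add: C)
  moreover have eq: "(\<phi> ^^ Suc n) ` C = (\<phi> ^^ n) ` \<phi> ` C" for n
    by (simp only: funpow_Suc_right image_comp)
  moreover from eq C(2) have "(\<phi> ^^ Suc n) ` C \<subseteq> (\<phi> ^^ n) ` C" for n
    using image_mono[OF C(2)] by (simp only: eq)
  ultimately obtain n where "(\<phi> ^^ Suc n) ` C = (\<phi> ^^ n) ` C"
    using zariski_descending_chain[of c "\<lambda>n. (\<phi> ^^ n) ` C"] by blast
  then have "(\<phi> ^^ n) ` \<phi> ` C = (\<phi> ^^ n) ` C" unfolding eq .
  then show ?thesis by (simp only: inj_image_eq_iff[OF inj])
qed

text \<open>Noetherian induction cuts \<open>G\<close> into finitely many connected pieces. Each
  component contains a nonempty piece, and different components contain different ones.\<close>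

lemma finite_connected_components_zariski:
  fixes c :: "'p \<Rightarrow> 'v::finite \<Rightarrow> 'a::field"
  shows "finite (connected_components_of (subtopology (zariski c) G))"
proof -
  let ?X = "zariski c"
  let ?r = "{(C, D). closedin ?X C \<and> C \<subset> D}"
  have wf: "wf ?r" unfolding wf_iff_no_infinite_down_chain
  proof
    assume "\<exists>f. \<forall>i. (f (Suc i), f i) \<in> ?r"
    then obtain f where f: "\<And>i. closedin ?X (f (Suc i)) \<and> f (Suc i) \<subset> f i" by auto
    then show False using zariski_descending_chain[of c "\<lambda>i. f (Suc i)"] by blast
  qed
  have "\<exists>\<K>. finite \<K> \<and> (\<forall>K\<in>\<K>. connectedin ?X K) \<and> C \<inter> G = \<Union>\<K>" if "closedin ?X C" for C
    using that
  proof (induction C rule: wf_induct_rule[OF wf])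
    case (1 C)
    show ?case
    proof (cases "connectedin ?X (C \<inter> G)")
      case True
      then show ?thesis by (intro exI[of _ "{C \<inter> G}"]) auto
    next
      case False
      then obtain E F where EF: "closedin ?X E" "closedin ?X F" "C \<inter> G \<subseteq> E \<union> F"
        "E \<inter> F \<inter> (C \<inter> G) = {}" "E \<inter> (C \<inter> G) \<noteq> {}" "F \<inter> (C \<inter> G) \<noteq> {}"
        unfolding connectedin_closedin by auto
      have "closedin ?X (C \<inter> E)" "closedin ?X (C \<inter> F)" using 1(2) EF by auto
      moreover have "C \<inter> E \<subset> C" "C \<inter> F \<subset> C" using EF by blast+
      ultimately obtain \<K> \<L> where "finite \<K>" "\<forall>K\<in>\<K>. connectedin ?X K" "C \<inter> E \<inter> G = \<Union>\<K>"
        "finite \<L>" "\<forall>K\<in>\<L>. connectedin ?X K" "C \<inter> F \<inter> G = \<Union>\<L>"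
        using 1(1)[of "C \<inter> E"] 1(1)[of "C \<inter> F"] by auto
      moreover have "C \<inter> G = (C \<inter> E \<inter> G) \<union> (C \<inter> F \<inter> G)" using EF by blast
      ultimately show ?thesis by (intro exI[of _ "\<K> \<union> \<L>"]) auto
    qed
  qed
  from this[of UNIV] obtain \<K> where \<K>: "finite \<K>" "\<And>K. K \<in> \<K> \<Longrightarrow> connectedin ?X K" "G = \<Union>\<K>"
    using closedin_topspace[of ?X] by auto
  let ?Y = "subtopology ?X G"
  have "\<forall>C\<in>connected_components_of ?Y. \<exists>K\<in>\<K>. K \<noteq> {} \<and> K \<subseteq> C"
  proof
    fix C assume C: "C \<in> connected_components_of ?Y"
    then obtain x where x: "x \<in> C" using nonempty_connected_components_of by fastforce
    then have "x \<in> G" using connected_components_of_subset[OF C] by auto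
    then obtain K where K: "K \<in> \<K>" "x \<in> K" using \<K>(3) by blast
    then have "connectedin ?Y K" using \<K> by (auto simp: connectedin_subtopology)
    then have "K \<subseteq> C" using connected_components_of_maximal[OF C] K x by (auto simp: disjnt_iff)
    then show "\<exists>K\<in>\<K>. K \<noteq> {} \<and> K \<subseteq> C" using K by blast
  qed
  then obtain g where g: "\<And>C. C \<in> connected_components_of ?Y \<Longrightarrow> g C \<in> \<K> \<and> g C \<noteq> {} \<and> g C \<subseteq> C"
    by metis
  have "inj_on g (connected_components_of ?Y)"
  proof (rule inj_onI)
    fix C D assume CD: "C \<in> connected_components_of ?Y" "D \<in> connected_components_of ?Y" "g C = g D"
    then have "\<not> disjnt C D" using g[of C] g[of D] by (auto simp: disjnt_def)
    then show "C = D"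
      using CD pairwise_disjoint_connected_components_of[of ?Y] by (auto simp: pairwise_def)
  qed
  moreover have "g ` connected_components_of ?Y \<subseteq> \<K>" using g by blast
  ultimately show ?thesis using \<K>(1) inj_on_finite by blast
qed

section \<open>Shift-invariant sets and a counting lemma\<close>

text \<open>A closed set is given by finitely many equations, so it is constructible in coordinates;
  surjectivity of \<open>c\<close> guarantees that every coordinate vector comes from a
  point.\<close>

lemma constructible_image_closed:
  fixes c :: "'p \<Rightarrow> 'v::finite \<Rightarrow> 'a::field"
  assumes "surj c" "closedin (zariski c) C" "closedin (zariski c) D"
  shows "c ` (C - D) \<in> constructible"
proof -
  have "\<exists>Z\<in>constructible. C = c -` Z" if C: "closedin (zariski c) C" for C
  proof -
    obtain S where "C = zero_locus c S" using C unfolding closedin_zariski by blast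
    then obtain F where F: "finite F" "C = zero_locus c F"
      using zero_locus_finite[of S c] by auto
    let ?Z = "- (\<Union>f\<in>F. {\<sigma>. mpoly_eval f \<sigma> \<noteq> 0})"
    have "?Z \<in> constructible"
      using F(1) by (intro constructible.compl constructible_Union) (auto simp: constructible_nonzeros)
    moreover have "C = c -` ?Z" unfolding F zero_locus_def by auto
    ultimately show ?thesis by blast
  qed
  from this[OF assms(2)] this[OF assms(3)] obtain Z Z'
    where Z: "Z \<in> constructible" "C = c -` Z" "Z' \<in> constructible" "D = c -` Z'" by blast
  have "c ` (C - D) = c ` (c -` (Z \<inter> - Z'))" unfolding Z by auto
  also have "\<dots> = Z \<inter> - Z'" using assms(1) by (rule surj_image_vimage_eq)
  finally have "c ` (C - D) = Z \<inter> - Z'" .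
  then show ?thesis using Z by (simp add: constructible.compl constructible.inter)
qed

lemma shift_invariant_meets_fibre:
  fixes c :: "'p \<Rightarrow> 'v::finite \<Rightarrow> 'a::{alg_closed_field, field_char_0}"
  assumes c: "surj c" "closedin (zariski c) C" "closedin (zariski c) D"
    and ne: "C - D \<noteq> {}" and inv: "\<phi> ` (C - D) = C - D"
    and shift: "\<And>P. c (\<phi> P) v = c P v + of_nat m" and m: "m \<ge> 1"
  shows "\<exists>P\<in>C - D. c P v = 0"
proof -
  define B where "B = (\<lambda>\<sigma>. \<sigma> v) ` c ` (C - D)"
  \<comment> \<open>Equality in \<open>inv\<close>, and not just an inclusion, allows moving
    backwards as well.\<close>
  have B: "x + of_nat m \<in> B \<longleftrightarrow> x \<in> B" for x
  proof
    assume "x \<in> B"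
    then obtain P where "P \<in> C - D" "x = c P v" unfolding B_def by auto
    then show "x + of_nat m \<in> B" using inv shift unfolding B_def image_comp
      by (intro image_eqI[of _ _ "\<phi> P"]) auto
  next
    assume "x + of_nat m \<in> B"
    then obtain P where "P \<in> C - D" "x + of_nat m = c P v" unfolding B_def by auto
    moreover from this obtain Q where "Q \<in> C - D" "P = \<phi> Q" using inv by blast
    ultimately show "x \<in> B" using shift[of Q] unfolding B_def by auto
  qed
  have Bn: "x + of_nat (m * n) \<in> B \<longleftrightarrow> x \<in> B" for x n
  proof (induction n)
    case (Suc n)
    have "x + of_nat (m * Suc n) = (x + of_nat (m * n)) + of_nat m" by simp
    then show ?case using B Suc by metis
  qed simp
  \<comment> \<open>Characteristic zero makes the multiples of \<open>m\<close> distinct.\<close>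
  have inj: "inj (\<lambda>n. x + of_nat (m * n) :: 'a)" for x using m by (auto intro!: injI)
  obtain x where "x \<in> B" using ne unfolding B_def by blast
  then have "range (\<lambda>n. x + of_nat (m * n)) \<subseteq> B" using Bn by blast
  then have "infinite B" using range_inj_infinite[OF inj] finite_subset by blast
  then have "finite (- B)"
    using constructible_projection[OF constructible_image_closed[OF c]] unfolding B_def by blast
  \<comment> \<open>A finite complement cannot contain all multiples of \<open>m\<close>; from one
    multiple in \<open>B\<close>, invariance leads back to 0.\<close>
  then have "\<not> range (\<lambda>n. 0 + of_nat (m * n)) \<subseteq> - B"
    using range_inj_infinite[OF inj] finite_subset by blast
  then have "0 \<in> B" using Bn[of 0] by blast
  then show ?thesis unfolding B_def by force
qed

text \<open>The map \<open>T\<close> injects each class of \<open>\<tau>\<close> into the next, so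
  class sizes cannot decrease along the cycle; since \<open>m\<close> steps return to the start,
  they are all equal. Taking \<open>i mod m\<close> in \<open>k\<close> makes index \<open>m\<close>
  denote the class 0 again.\<close>

lemma dvd_card_if_cyclic_shift:
  assumes "finite K" and \<tau>: "\<And>x. x \<in> K \<Longrightarrow> \<tau> x < m"
    and T: "inj_on T K" "T ` K \<subseteq> K" "\<And>x. x \<in> K \<Longrightarrow> \<tau> (T x) = (\<tau> x + 1) mod m"
  shows "m dvd card K"
proof -
  define k where "k i = card {x \<in> K. \<tau> x = i mod m}" for i
  have "k i \<le> k (Suc i)" for i
    unfolding k_def
  proof (rule card_inj_on_le[of T])
    show "inj_on T {x \<in> K. \<tau> x = i mod m}" using T(1) by (rule inj_on_subset) auto
    show "T ` {x \<in> K. \<tau> x = i mod m} \<subseteq> {x \<in> K. \<tau> x = Suc i mod m}"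
      using T(2,3) by (auto simp: mod_Suc_eq)
  qed (use assms(1) in auto)
  then have mono: "i \<le> j \<Longrightarrow> k i \<le> k j" for i j by (rule lift_Suc_mono_le)
  have "k m = k 0" unfolding k_def by simp
  then have eq: "k i = k 0" if "i < m" for i using mono[of 0 i] mono[of i m] that by simp
  have "K = (\<Union>i\<in>{..<m}. {x \<in> K. \<tau> x = i mod m})" using \<tau> by auto
  then have "card K = card (\<Union>i\<in>{..<m}. {x \<in> K. \<tau> x = i mod m})" by simp
  also have "\<dots> = (\<Sum>i<m. k i)"
    unfolding k_def by (rule card_UN_disjoint) (use assms(1) in auto)
  also have "\<dots> = (\<Sum>i<m. k 0)" by (rule sum.cong) (use eq in blast)+
  finally show ?thesis by simp
qed

section \<open>The skew map\<close>

text \<open>The linear action lifted to matrices: the orbit of \<open>(0, mat 1)\<close> lists the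
  products \<open>A(n - 1) \<cdots> A(0)\<close>.\<close>

definition skew_mat :: "'a::field poly^'n^'n \<Rightarrow> 'a \<times> ('a^'n^'n) \<Rightarrow> 'a \<times> ('a^'n^'n)" where
  "skew_mat A = (\<lambda>(x, M). (x + 1, eval_mat A x ** M))"

definition coords_prod_mat :: "'a \<times> ('a^'n^'n) \<Rightarrow> ('n \<times> 'n) option \<Rightarrow> 'a" where
  "coords_prod_mat P = (\<lambda>i. case i of None \<Rightarrow> fst P | Some (i, j) \<Rightarrow> snd P $ i $ j)"

lemma coords_prod_simps [simp]:
  "coords_prod P None = fst P" "coords_prod P (Some i) = snd P $ i"
  by (simp_all add: coords_prod_def)

lemma coords_prod_mat_simps [simp]:
  "coords_prod_mat P None = fst P" "coords_prod_mat P (Some (i, j)) = snd P $ i $ j"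
  by (simp_all add: coords_prod_mat_def)

lemma surj_coords_prod: "surj (coords_prod :: 'a \<times> ('a^'n) \<Rightarrow> _)"
proof (rule surjI)
  show "coords_prod (s None, \<chi> i. s (Some i)) = s" for s :: "'n option \<Rightarrow> 'a"
    by (rule ext) (simp add: coords_prod_def split: option.split)
qed

lemma surj_coords_prod_mat: "surj (coords_prod_mat :: 'a \<times> ('a^'n^'n) \<Rightarrow> _)"
proof (rule surjI)
  show "coords_prod_mat (s None, \<chi> i j. s (Some (i, j))) = s" for s :: "('n \<times> 'n) option \<Rightarrow> 'a"
    by (rule ext) (simp add: coords_prod_mat_def split: option.split)
qed

lemma polyfun_coords_prod [intro]:
  "fst \<in> polyfun (coords_prod :: 'a::comm_ring_1 \<times> ('a^'n) \<Rightarrow> _)"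
  "(\<lambda>P. snd P $ i) \<in> polyfun (coords_prod :: 'a::comm_ring_1 \<times> ('a^'n) \<Rightarrow> _)"
  using polyfun_coord[of coords_prod None] polyfun_coord[of coords_prod "Some i"] by simp_all

lemma polyfun_coords_prod_mat [intro]:
  "fst \<in> polyfun (coords_prod_mat :: 'a::comm_ring_1 \<times> ('a^'n^'n) \<Rightarrow> _)"
  "(\<lambda>P. snd P $ i $ j) \<in> polyfun (coords_prod_mat :: 'a::comm_ring_1 \<times> ('a^'n^'n) \<Rightarrow> _)"
  using polyfun_coord[of coords_prod_mat None] polyfun_coord[of coords_prod_mat "Some (i, j)"]
  by simp_all

lemma polyfun_coords_mat [intro]:
  "(\<lambda>M. M $ i $ j) \<in> polyfun (coords_mat :: 'a::comm_ring_1^'n^'n \<Rightarrow> _)"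
  using polyfun_coord[of coords_mat "(i, j)"] by (simp add: coords_mat_def)

lemmas polyfun_intros = polyfun_const polyfun_add polyfun_diff polyfun_mult polyfun_sum polyfun_prod
  polyfun_poly polyfun_coords_prod polyfun_coords_prod_mat polyfun_coords_mat

lemma polyfun_coords_prodI:
  assumes "(\<lambda>P. fst (\<phi> P)) \<in> polyfun c" "\<And>i. (\<lambda>P. snd (\<phi> P) $ i) \<in> polyfun c"
  shows "(\<lambda>P. coords_prod (\<phi> P) v) \<in> polyfun c"
  using assms by (cases v) auto

lemma polyfun_coords_prod_matI:
  assumes "(\<lambda>P. fst (\<phi> P)) \<in> polyfun c" "\<And>i j. (\<lambda>P. snd (\<phi> P) $ i $ j) \<in> polyfun c"
  shows "(\<lambda>P. coords_prod_mat (\<phi> P) v) \<in> polyfun c"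
  using assms by (cases v) auto

lemma eval_mat_mult: "eval_mat (A ** B) x = eval_mat A x ** eval_mat B x"
  by (simp add: eval_mat_def matrix_matrix_mult_def vec_eq_iff poly_sum)

lemma eval_mat_one: "eval_mat (mat 1) x = mat 1"
  by (simp add: eval_mat_def mat_def vec_eq_iff)

lemma eval_mat_invertible: "invertible A \<Longrightarrow> invertible (eval_mat A x)"
  unfolding invertible_def by (metis eval_mat_mult eval_mat_one)

text \<open>Invertibility over the polynomial ring provides an inverse matrix \<open>B\<close> with
  polynomial entries, so the inverse map \<open>\<psi>\<close> is again a morphism and images of
  closed sets are closed.\<close>

lemma skew_map_closed_bij:
  assumes "invertible (A :: 'a::field poly^'n^'n)"
  shows "inj (skew_map A)"
    "closedin (zariski coords_prod) V \<Longrightarrow> closedin (zariski coords_prod) (skew_map A ` V)"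
    "closedin (zariski coords_prod) V \<Longrightarrow> closedin (zariski coords_prod) (skew_map A -` V)"
proof -
  obtain B where AB: "A ** B = mat 1" "B ** A = mat 1" using assms unfolding invertible_def by blast
  define \<psi> where "\<psi> = (\<lambda>P :: 'a \<times> ('a^'n). (fst P - 1, eval_mat B (fst P - 1) *v snd P))"
  have inv: "eval_mat A x *v (eval_mat B x *v y) = y" "eval_mat B x *v (eval_mat A x *v y) = y" for x y
    by (simp_all add: matrix_vector_mul_assoc eval_mat_mult[symmetric] AB eval_mat_one)
  have \<psi>: "\<psi> (skew_map A P) = P" "skew_map A (\<psi> P) = P" for P
    by (auto simp: \<psi>_def skew_map_def inv split: prod.split)
  show "inj (skew_map A)" using \<psi>(1) by (metis injI)
  have "(\<lambda>P. coords_prod (\<psi> P) v) \<in> polyfun coords_prod" for v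
    by (rule polyfun_coords_prodI)
      (auto simp: \<psi>_def eval_mat_def matrix_vector_mult_def intro!: polyfun_intros)
  then show "closedin (zariski coords_prod) V \<Longrightarrow> closedin (zariski coords_prod) (skew_map A ` V)"
    using closedin_image[of coords_prod \<psi> coords_prod "skew_map A" V] \<psi> by blast
  have "(\<lambda>P. coords_prod (skew_map A P) v) \<in> polyfun coords_prod" for v
    by (rule polyfun_coords_prodI)
      (auto simp: skew_map_def case_prod_unfold eval_mat_def matrix_vector_mult_def intro!: polyfun_intros)
  then show "closedin (zariski coords_prod) V \<Longrightarrow> closedin (zariski coords_prod) (skew_map A -` V)"
    using closedin_vimage[of coords_prod "skew_map A" coords_prod V] by blast
qed

lemma skew_mat_closed_bij:
  assumes "invertible (A :: 'a::field poly^'n^'n)"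
  shows "inj (skew_mat A)"
    "closedin (zariski coords_prod_mat) V \<Longrightarrow> closedin (zariski coords_prod_mat) (skew_mat A ` V)"
    "closedin (zariski coords_prod_mat) V \<Longrightarrow> closedin (zariski coords_prod_mat) (skew_mat A -` V)"
    "surj (skew_mat A)"
proof -
  obtain B where AB: "A ** B = mat 1" "B ** A = mat 1" using assms unfolding invertible_def by blast
  define \<psi> where "\<psi> = (\<lambda>P :: 'a \<times> ('a^'n^'n). (fst P - 1, eval_mat B (fst P - 1) ** snd P))"
  have inv: "eval_mat A x ** (eval_mat B x ** y) = y" "eval_mat B x ** (eval_mat A x ** y) = y" for x y
    by (simp_all add: matrix_mul_assoc eval_mat_mult[symmetric] AB eval_mat_one)
  have \<psi>: "\<psi> (skew_mat A P) = P" "skew_mat A (\<psi> P) = P" for P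
    by (auto simp: \<psi>_def skew_mat_def inv split: prod.split)
  show "inj (skew_mat A)" using \<psi>(1) by (metis injI)
  show "surj (skew_mat A)" using \<psi>(2) by (metis surjI)
  have "(\<lambda>P. coords_prod_mat (\<psi> P) v) \<in> polyfun coords_prod_mat" for v
    by (rule polyfun_coords_prod_matI)
      (auto simp: \<psi>_def eval_mat_def matrix_matrix_mult_def intro!: polyfun_intros)
  then show "closedin (zariski coords_prod_mat) V \<Longrightarrow> closedin (zariski coords_prod_mat) (skew_mat A ` V)"
    using closedin_image[of coords_prod_mat \<psi> coords_prod_mat "skew_mat A" V] \<psi> by blast
  have "(\<lambda>P. coords_prod_mat (skew_mat A P) v) \<in> polyfun coords_prod_mat" for v
    by (rule polyfun_coords_prod_matI)
      (auto simp: skew_mat_def case_prod_unfold eval_mat_def matrix_matrix_mult_def intro!: polyfun_intros)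
  then show "closedin (zariski coords_prod_mat) V \<Longrightarrow> closedin (zariski coords_prod_mat) (skew_mat A -` V)"
    using closedin_vimage[of coords_prod_mat "skew_mat A" coords_prod_mat V] by blast
qed

lemma funpow_image_closed:
  assumes "\<And>V. closedin X V \<Longrightarrow> closedin X (\<phi> ` V)" "closedin X V"
  shows "closedin X ((\<phi> ^^ n) ` V)"
proof (induction n)
  case (Suc n)
  then show ?case using assms(1)[of "(\<phi> ^^ n) ` V"] by (simp add: image_comp)
qed (simp add: assms(2))

lemma funpow_vimage_closed:
  assumes "\<And>V. closedin X V \<Longrightarrow> closedin X (\<phi> -` V)" "closedin X V"
  shows "closedin X ((\<phi> ^^ n) -` V)"
proof (induction n)
  case (Suc n)
  then show ?case using assms(1)[of "(\<phi> ^^ n) -` V"]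
    by (simp only: funpow_Suc_right vimage_comp[symmetric])
qed (simp add: assms(2))

lemma fst_skew_map_funpow: "fst ((skew_map A ^^ n) P) = fst P + of_nat n"
  by (induction n) (auto simp: skew_map_def case_prod_unfold)

lemma fst_skew_mat_funpow: "fst ((skew_mat A ^^ n) P) = fst P + of_nat n"
  by (induction n) (auto simp: skew_mat_def case_prod_unfold)

lemma invertible_matrix_vector_inj:
  assumes "invertible h" "h *v x = h *v y"
  shows "x = y"
  using assms unfolding invertible_def
  by (metis matrix_vector_mul_assoc matrix_vector_mul_lid)

lemma det_skew_mat_funpow:
  assumes "invertible (A :: 'a::field poly^'n^'n)"
  shows "det (snd ((skew_mat A ^^ n) P)) = 0 \<longleftrightarrow> det (snd P) = 0"
proof (induction n)
  case (Suc n)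
  have "det (eval_mat A x) \<noteq> 0" for x
    using eval_mat_invertible[OF assms] by (simp add: invertible_det_nz)
  then show ?case using Suc by (simp add: skew_mat_def case_prod_unfold det_mul)
qed simp

section \<open>Evaluation at a vector and the shift matrix\<close>

definition act :: "'a::field^'n \<Rightarrow> 'a \<times> ('a^'n^'n) \<Rightarrow> 'a \<times> ('a^'n)" where
  "act u = (\<lambda>(x, M). (x, M *v u))"

text \<open>Evaluation at \<open>u\<close> intertwines the two skew maps, so a single matrix orbit
  controls the orbits of all vectors simultaneously.\<close>

lemma skew_map_act: "skew_map A (act u P) = act u (skew_mat A P)"
  by (simp add: act_def skew_map_def skew_mat_def case_prod_unfold matrix_vector_mul_assoc)

lemma skew_map_funpow_act: "(skew_map A ^^ n) (act u P) = act u ((skew_mat A ^^ n) P)"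
  by (induction n) (simp_all add: skew_map_act)

text \<open>The witness \<open>h\<close> lies in the fibre over \<open>0\<close> of the closure of the orbit points
  \<open>(m n + 1, A(m n) \<cdots> A(0))\<close>, so it acts on fibres of \<open>f\<^sup>m\<close>-invariant sets as \<open>f\<close> does.\<close>

lemma exists_shift_matrix:
  fixes A :: "'a::{alg_closed_field, field_char_0} poly^'n^'n"
  assumes A: "invertible A" and m: "m \<ge> 1"
  shows "\<exists>h. invertible h \<and> (\<forall>X u. closedin (zariski coords_prod) X \<longrightarrow>
    (skew_map A ^^ m) ` X = X \<longrightarrow> (0, u) \<in> X \<longrightarrow> (0, h *v u) \<in> skew_map A ` X)"
proof -
  let ?Z = "zariski (coords_prod_mat :: 'a \<times> ('a^'n^'n) \<Rightarrow> _)" and ?G = "skew_mat A" and ?f = "skew_map A"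
  \<comment> \<open>The exponents are one more than a multiple of \<open>m\<close>, so that these
    points act like a single application of \<open>f\<close> on sets invariant under
    \<open>f ^^ m\<close>.\<close>
  define Orb where "Orb = range (\<lambda>n. (?G ^^ (m * n + 1)) (0, mat 1))"
  define Y where "Y = ?Z closure_of Orb"
  define D :: "('a \<times> ('a^'n^'n)) set" where "D = {P. det (snd P) = 0}"
  have Y: "closedin ?Z Y" unfolding Y_def by simp
  have OrbY: "Orb \<subseteq> Y" unfolding Y_def by (rule closure_of_subset) simp
  have minimal: "Y \<subseteq> C" if "closedin ?Z C" "Orb \<subseteq> C" for C
    unfolding Y_def using that by (rule closure_of_minimal[rotated])
  have D: "closedin ?Z D"
    unfolding D_def det_def by (rule closedin_zeros) (auto intro!: polyfun_intros)
  have "(?G ^^ m) ` Orb \<subseteq> Orb"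
  proof -
    have "(?G ^^ m) ((?G ^^ (m * n + 1)) P) = (?G ^^ (m * Suc n + 1)) P" for n P
      by (simp only: funpow_add[symmetric, THEN fun_cong, unfolded comp_def])
        (simp add: algebra_simps)
    then show ?thesis unfolding Orb_def by blast
  qed
  then have "Orb \<subseteq> (?G ^^ m) -` Y" using OrbY by blast
  \<comment> \<open>The preimage of \<open>Y\<close> is closed and contains the orbit, so it
    contains the closure; the descending chain argument improves this inclusion to equality.\<close>
  then have "Y \<subseteq> (?G ^^ m) -` Y"
    using funpow_vimage_closed[of ?Z ?G, OF skew_mat_closed_bij(3)[OF A] Y] minimal by blast
  then have "(?G ^^ m) ` Y = Y"
    using Y inj_fn[OF skew_mat_closed_bij(1)[OF A]]
      funpow_image_closed[of ?Z ?G, OF skew_mat_closed_bij(2)[OF A]]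
    by (intro closed_image_subset_imp_eq[of _ coords_prod_mat]) auto
  moreover have "(?G ^^ m) ` D = D"
  proof -
    have "(?G ^^ m) -` D = D" unfolding D_def using det_skew_mat_funpow[OF A] by auto
    moreover have "surj (?G ^^ m)" using skew_mat_closed_bij(4)[OF A] by (rule surj_fn)
    ultimately show ?thesis by (metis surj_image_vimage_eq)
  qed
  ultimately have inv: "(?G ^^ m) ` (Y - D) = Y - D"
    by (simp add: image_set_diff[OF inj_fn[OF skew_mat_closed_bij(1)[OF A]]])
  \<comment> \<open>The orbit point for \<open>n = 0\<close> is \<open>(1, A(0))\<close>, whose
    matrix is invertible, so \<open>Y - D\<close> is nonempty.\<close>
  have "(?G ^^ (m * 0 + 1)) (0, mat 1) \<in> Y - D"
    using OrbY det_skew_mat_funpow[OF A, of "m * 0 + 1" "(0, mat 1)"] unfolding Orb_def D_def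
    by (metis (mono_tags, lifting) DiffI det_I mem_Collect_eq rangeI snd_conv subsetD zero_neq_one)
  then have "\<exists>P\<in>Y - D. coords_prod_mat P None = 0"
    by (intro shift_invariant_meets_fibre[OF surj_coords_prod_mat Y D _ inv _ m])
      (auto simp: fst_skew_mat_funpow)
  then obtain P where P: "P \<in> Y" "P \<notin> D" "fst P = 0" by auto
  define h where "h = snd P"
  have "P = (0, h)" using P(3) by (simp add: h_def prod_eq_iff)
  then have h: "(0, h) \<in> Y" "det h \<noteq> 0" using P unfolding D_def by auto
  have "(0, h *v u) \<in> ?f ` X"
    if X: "closedin (zariski coords_prod) X" "(?f ^^ m) ` X = X" "(0, u) \<in> X" for X u
  proof -
    have "(\<lambda>P. coords_prod (act u P) v) \<in> polyfun coords_prod_mat" for v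
      by (rule polyfun_coords_prodI)
        (auto simp: act_def case_prod_unfold matrix_vector_mult_def intro!: polyfun_intros)
    then have "closedin ?Z (act u -` (?f ` X))"
      using closedin_vimage[of coords_prod "act u" coords_prod_mat "?f ` X"]
        skew_map_closed_bij(2)[OF A X(1)] by blast
    \<comment> \<open>Evaluated at \<open>u\<close>, orbit points become \<open>f\<close> applied to
      points of \<open>X\<close>; this closed condition passes to all of \<open>Y\<close>, in
      particular to \<open>(0, h)\<close>.\<close>
    moreover have "Orb \<subseteq> act u -` (?f ` X)"
    proof -
      have *: "(?f ^^ (m * n)) P \<in> X" if "P \<in> X" for n P
        using that X(2) by (induction n arbitrary: P) (auto simp: funpow_add)
      have "act u ((?G ^^ (m * n + 1)) (0, mat 1)) = ?f ((?f ^^ (m * n)) (0, u))" for n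
        using skew_map_funpow_act[of "m * n + 1" A u "(0, mat 1)"] by (simp add: act_def)
      then show ?thesis using * X(3) unfolding Orb_def by auto
    qed
    ultimately have "(0, h) \<in> act u -` (?f ` X)" using minimal h by blast
    then show ?thesis by (simp add: act_def)
  qed
  then show ?thesis using h by (auto simp: invertible_det_nz)
qed

section \<open>Orbits of periodic sets\<close>

lemma funpow_image_multiple: "(f ^^ m) ` X = X \<Longrightarrow> (f ^^ (m * n)) ` X = X"
proof (induction n)
  case (Suc n)
  have "(f ^^ (m * Suc n)) ` X = (f ^^ m) ` ((f ^^ (m * n)) ` X)"
    by (simp add: funpow_add image_comp)
  then show ?case using Suc by simp
qed simp

lemma funpow_image_mod:
  assumes "(f ^^ m) ` X = X"
  shows "(f ^^ (n mod m)) ` X = (f ^^ n) ` X"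
proof -
  have "(f ^^ n) ` X = (f ^^ (n mod m + m * (n div m))) ` X" by simp
  also have "\<dots> = (f ^^ (n mod m)) ` ((f ^^ (m * (n div m))) ` X)"
    by (simp only: funpow_add image_comp)
  finally show ?thesis by (simp only: funpow_image_multiple[OF assms])
qed

text \<open>Dominance comes from the orbit of one point: it has infinitely many first coordinates in
  characteristic zero, and a univariate polynomial vanishing at all of them is zero.\<close>

lemma invariant_dominantI:
  fixes A :: "'a::field_char_0 poly^'n^'n"
  assumes E: "closedin (zariski coords_prod) E" "E \<noteq> {}" "skew_map A ` E = E"
  shows "E \<in> invariant_dominant A"
proof -
  obtain P where P: "P \<in> E" using E(2) by blast
  have "(skew_map A ^^ n) P \<in> E" for n using P E(3) by (induction n) auto
  then have *: "fst P + of_nat n \<in> fst ` E" for n using fst_skew_map_funpow[of n A P] by (metis imageI)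
  have "inj (\<lambda>n. fst P + of_nat n)" by (auto intro: injI)
  then have inf: "infinite (fst ` E)"
    using * range_inj_infinite finite_subset by (metis image_subsetI)
  let ?C = "zariski coords_line closure_of (fst ` E)"
  have "closedin (zariski coords_line) ?C" by simp
  then obtain S where S: "?C = zero_locus coords_line S" unfolding closedin_zariski by blast
  have sub: "fst ` E \<subseteq> ?C" by (rule closure_of_subset) simp
  have "mpoly_eval p (coords_line x) = 0" if p: "p \<in> S" for p x
  proof -
    obtain Q where Q: "\<And>x. poly Q x = mpoly_eval p (\<lambda>_. x)" using mpoly_diagonal by metis
    have "fst ` E \<subseteq> {x. poly Q x = 0}"
      using sub p unfolding S zero_locus_def Q coords_line_def by blast
    then have "infinite {x. poly Q x = 0}" using inf finite_subset by blast
    then have "Q = 0" using poly_roots_finite by blast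
    then show ?thesis using Q[of x] by (simp add: coords_line_def)
  qed
  then have "?C = UNIV" unfolding S zero_locus_def by blast
  then show ?thesis using E unfolding invariant_dominant_def by blast
qed

lemma invariant_dominant_orbit:
  fixes A :: "'a::field_char_0 poly^'n^'n"
  assumes A: "invertible A" and X: "closedin (zariski coords_prod) X" "X \<noteq> {}"
    and m: "m \<ge> 1" "(skew_map A ^^ m) ` X = X"
  shows "(\<Union>l<m. (skew_map A ^^ l) ` X) \<in> invariant_dominant A"
proof (rule invariant_dominantI)
  show "closedin (zariski coords_prod) (\<Union>l<m. (skew_map A ^^ l) ` X)"
    using m funpow_image_closed[OF skew_map_closed_bij(2)[OF A] X(1)]
    by (intro closedin_Union) auto
  show "(\<Union>l<m. (skew_map A ^^ l) ` X) \<noteq> {}" using m X by (auto intro!: exI[of _ 0])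
  have eq: "skew_map A ` (skew_map A ^^ l) ` X = (skew_map A ^^ Suc l) ` X" for l
    by (simp add: image_comp)
  show "skew_map A ` (\<Union>l<m. (skew_map A ^^ l) ` X) = (\<Union>l<m. (skew_map A ^^ l) ` X)"
  proof (intro subset_antisym subsetI)
    fix P assume "P \<in> skew_map A ` (\<Union>l<m. (skew_map A ^^ l) ` X)"
    then obtain l where "P \<in> (skew_map A ^^ Suc l) ` X" using eq by blast
    then have "P \<in> (skew_map A ^^ (Suc l mod m)) ` X" by (simp only: funpow_image_mod[OF m(2)])
    moreover have "Suc l mod m < m" using m by simp
    ultimately show "P \<in> (\<Union>l<m. (skew_map A ^^ l) ` X)" by blast
  next
    fix P assume "P \<in> (\<Union>l<m. (skew_map A ^^ l) ` X)"
    then obtain l where l: "l < m" "P \<in> (skew_map A ^^ l) ` X" by blast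
    \<comment> \<open>The index preceding \<open>l\<close> modulo \<open>m\<close>; adding
      \<open>m - 1\<close> avoids truncated subtraction at \<open>l = 0\<close>.\<close>
    let ?k = "(l + (m - 1)) mod m"
    have "(skew_map A ^^ Suc ?k) ` X = skew_map A ` (skew_map A ^^ ?k) ` X" by (simp only: eq)
    also have "\<dots> = (skew_map A ^^ Suc (l + (m - 1))) ` X"
      by (simp only: funpow_image_mod[OF m(2)] eq)
    also have "\<dots> = (skew_map A ^^ ((l + m) mod m)) ` X"
      using m by (simp only: funpow_image_mod[OF m(2)]) simp
    also have "\<dots> = (skew_map A ^^ l) ` X" using l by simp
    finally have "P \<in> skew_map A ` (skew_map A ^^ ?k) ` X" using l by (simp only: eq)
    moreover have "?k < m" using m by simp
    ultimately show "P \<in> skew_map A ` (\<Union>l<m. (skew_map A ^^ l) ` X)" by blast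
  qed
qed

section \<open>The stabilizer group\<close>

lemma GL_stabilizer_mult:
  assumes "g \<in> GL_stabilizer W" "h \<in> GL_stabilizer W"
  shows "g ** h \<in> GL_stabilizer W"
proof -
  have "(\<lambda>y. (g ** h) *v y) ` W = (\<lambda>y. g *v y) ` (\<lambda>y. h *v y) ` W"
    by (simp add: image_image matrix_vector_mul_assoc)
  then show ?thesis using assms by (simp add: GL_stabilizer_def invertible_mult)
qed

lemma GL_stabilizer_inverse:
  assumes "g \<in> GL_stabilizer W" "g ** h = mat 1" "h ** g = mat 1"
  shows "h \<in> GL_stabilizer W"
proof -
  have "(\<lambda>y. h *v y) ` W = (\<lambda>y. h *v y) ` (\<lambda>y. g *v y) ` W"
    using assms(1) by (simp add: GL_stabilizer_def)
  also have "\<dots> = W" by (simp add: image_image matrix_vector_mul_assoc assms(3))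
  finally show ?thesis using assms by (auto simp: GL_stabilizer_def invertible_def)
qed

lemma mat_1_in_group_of: "mat 1 \<in> group_of A"
  by (auto simp: group_of_def GL_stabilizer_def invertible_def)

text \<open>The hypothesis gives only that \<open>h\<close> maps each fibre into itself; fibres are
  closed, so the descending chain property makes this an equality.\<close>

lemma group_of_shift_matrix:
  fixes A :: "'a::field poly^'n^'n"
  assumes h: "invertible h" and
    "\<And>X u. closedin (zariski coords_prod) X \<Longrightarrow> skew_map A ` X = X \<Longrightarrow> (0, u) \<in> X \<Longrightarrow>
      (0, h *v u) \<in> X"
  shows "h \<in> group_of A"
proof -
  have "h \<in> GL_stabilizer (fibre_zero X)" if X: "X \<in> invariant_dominant A" for X
  proof -
    let ?Z = "zariski (coords_prod :: 'a \<times> ('a^'n) \<Rightarrow> _)"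
    obtain h' where h': "h ** h' = mat 1" "h' ** h = mat 1" using h unfolding invertible_def by blast
    define \<phi> where "\<phi> g = (\<lambda>P :: 'a \<times> ('a^'n). (fst P, g *v snd P))" for g :: "'a^'n^'n"
    have \<phi>: "\<phi> h' (\<phi> h P) = P" "\<phi> h (\<phi> h' P) = P" for P
      by (simp_all add: \<phi>_def matrix_vector_mul_assoc h')
    have "(\<lambda>P. coords_prod (\<phi> h' P) v) \<in> polyfun coords_prod" for v
      by (rule polyfun_coords_prodI)
        (auto simp: \<phi>_def matrix_vector_mult_def intro!: polyfun_intros)
    then have closed: "closedin ?Z (\<phi> h ` C)" if "closedin ?Z C" for C
      using closedin_image[of coords_prod "\<phi> h'" coords_prod "\<phi> h" C] \<phi> that by blast
    \<comment> \<open>The fibre is treated as the closed slice of \<open>X\<close> over 0 inside the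
      product, where \<open>\<phi> h\<close> is a morphism that keeps the first coordinate.\<close>
    define C where "C = X \<inter> {P. fst P = 0}"
    have "closedin ?Z {P. fst P = 0}" by (rule closedin_zeros) (rule polyfun_coords_prod)
    then have C: "closedin ?Z C" using X unfolding C_def invariant_dominant_def by blast
    have "\<phi> h ` C \<subseteq> C"
      using assms(2)[of X] X unfolding C_def \<phi>_def invariant_dominant_def by auto
    then have "\<phi> h ` C = C"
      using C closed injI[of "\<phi> h"] \<phi>(1) by (intro closed_image_subset_imp_eq[of _ coords_prod]) metis+
    moreover have "C = (\<lambda>y. (0, y)) ` fibre_zero X" unfolding C_def fibre_zero_def by auto
    ultimately have "(\<lambda>y. (0 :: 'a, y)) ` (\<lambda>y. h *v y) ` fibre_zero X = (\<lambda>y. (0, y)) ` fibre_zero X"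
      by (simp add: image_image \<phi>_def)
    then have "(\<lambda>y. h *v y) ` fibre_zero X = fibre_zero X"
      by (subst (asm) inj_image_eq_iff) (auto intro: injI)
    then show ?thesis using h by (simp add: GL_stabilizer_def)
  qed
  then show ?thesis unfolding group_of_def by blast
qed

lemma polyfun_matrix_mult:
  "(\<lambda>M. coords_mat (h ** M) v) \<in> polyfun (coords_mat :: 'a::comm_ring_1^'n^'n \<Rightarrow> _)"
proof -
  obtain i j where v: "v = (i, j)" by fastforce
  have "(\<lambda>M. coords_mat (h ** M) v) = (\<lambda>M. \<Sum>k\<in>UNIV. h $ i $ k * M $ k $ j)"
    by (simp add: v coords_mat_def matrix_matrix_mult_def)
  then show ?thesis by (simp only:) (intro polyfun_intros)
qed

lemma homeomorphic_map_group_translation: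
  fixes A :: "'a::field poly^'n^'n"
  assumes h: "h \<in> group_of A" "invertible h"
  shows "homeomorphic_map (subtopology (zariski coords_mat) (group_of A))
    (subtopology (zariski coords_mat) (group_of A)) (\<lambda>M. h ** M)"
proof -
  let ?X = "subtopology (zariski coords_mat) (group_of A)"
  have *: "continuous_map ?X ?X (\<lambda>M. g ** M)" if "g \<in> group_of A" for g
  proof -
    have "continuous_map (zariski coords_mat) (zariski coords_mat) (\<lambda>M. g ** M)"
      by (rule continuous_map_zariski) (rule polyfun_matrix_mult)
    moreover have "(\<lambda>M. g ** M) \<in> group_of A \<rightarrow> group_of A"
      using that GL_stabilizer_mult unfolding group_of_def by blast
    ultimately show ?thesis
      by (simp add: continuous_map_in_subtopology continuous_map_from_subtopology)
  qed
  obtain g where g: "h ** g = mat 1" "g ** h = mat 1" using h(2) unfolding invertible_def by blast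
  then have "g \<in> group_of A" using h(1) GL_stabilizer_inverse unfolding group_of_def by blast
  then have "homeomorphic_maps ?X ?X (\<lambda>M. h ** M) (\<lambda>M. g ** M)"
    using * h g unfolding homeomorphic_maps_def by (simp add: matrix_mul_assoc)
  then show ?thesis by (rule homeomorphic_maps_imp_map)
qed

lemma group_of_fibre:
  assumes "E \<in> invariant_dominant A" "g \<in> group_of A"
  shows "(0, g *v u) \<in> E \<longleftrightarrow> (0, u) \<in> E"
proof -
  have "invertible g" "(\<lambda>y. g *v y) ` fibre_zero E = fibre_zero E"
    using assms unfolding group_of_def GL_stabilizer_def by auto
  moreover from this(1) have "inj (\<lambda>y. g *v y)"
    using invertible_matrix_vector_inj by (blast intro: injI)
  ultimately show ?thesis
    using inj_image_mem_iff[of "\<lambda>y. g *v y" u "fibre_zero E"] by (simp add: fibre_zero_def)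
qed

section \<open>Divisibility of the number of components by the period\<close>

lemma irreducible_closed_subset_Union:
  assumes V: "irreducible_closed X V" and "finite I" "\<And>i. i \<in> I \<Longrightarrow> closedin X (C i)"
    "V \<subseteq> (\<Union>i\<in>I. C i)"
  shows "\<exists>i\<in>I. V \<subseteq> C i"
  using assms(2-)
proof (induction I)
  case empty
  then show ?case using V by (simp add: irreducible_closed_def)
next
  case (insert i I)
  let ?U = "\<Union>j\<in>I. C j"
  have "closedin X (V \<inter> C i)" "closedin X (V \<inter> ?U)"
    using V insert by (auto simp: irreducible_closed_def intro!: closedin_Int closedin_Union)
  moreover have "V = (V \<inter> C i) \<union> (V \<inter> ?U)" using insert.prems by auto
  ultimately have "V = V \<inter> C i \<or> V = V \<inter> ?U"
    using V unfolding irreducible_closed_def by blast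
  then show ?case
  proof
    assume "V = V \<inter> ?U"
    then have "V \<subseteq> ?U" by blast
    then have "\<exists>i\<in>I. V \<subseteq> C i" using insert by simp
    then show ?thesis by blast
  qed blast
qed

lemma period_dvd_components:
  fixes A :: "'a::{alg_closed_field, field_char_0} poly^'n^'n"
  assumes A: "invertible A" and per: "periodic_subvariety A V"
  shows "period A V dvd card (group_components A)"
proof -
  let ?f = "skew_map A" and ?Z = "zariski (coords_prod :: 'a \<times> ('a^'n) \<Rightarrow> _)" and ?G = "group_of A"
  define m where "m = period A V"
  define V' where "V' i = (?f ^^ i) ` V" for i
  have irr: "irreducible_closed ?Z V" and "\<exists>n. n \<ge> 1 \<and> (?f ^^ n) ` V = V"
    using per unfolding periodic_subvariety_def by auto
  from LeastI_ex[OF this(2)] have m: "m \<ge> 1" "(?f ^^ m) ` V = V"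
    unfolding m_def period_def by auto
  have least: "(?f ^^ i) ` V \<noteq> V" if "1 \<le> i" "i < m" for i
    using not_less_Least[of i "\<lambda>n. n \<ge> 1 \<and> (?f ^^ n) ` V = V"] that
    unfolding m_def period_def by blast
  have closed: "closedin ?Z (V' i)" for i
    using irr funpow_image_closed[of ?Z ?f, OF skew_map_closed_bij(2)[OF A]]
    unfolding irreducible_closed_def V'_def by blast
  have injf: "inj (?f ^^ i)" for i using skew_map_closed_bij(1)[OF A] by (rule inj_fn)
  have V'_funpow: "(?f ^^ i) ` V' j = V' (i + j)" for i j
    unfolding V'_def by (simp only: funpow_add image_comp)
  have V'_mod: "V' (i mod m) = V' i" for i
    unfolding V'_def by (rule funpow_image_mod[OF m(2)])
  have V'_period: "(?f ^^ m) ` V' i = V' i" for i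
    unfolding V'_funpow using V'_mod by (metis mod_add_self1)
  have V'_0: "V' 0 = V" unfolding V'_def by simp
  \<comment> \<open>An inclusion of \<open>V\<close> in \<open>V' i\<close> would propagate to a
    chain \<open>V \<subseteq> V' i \<subseteq> V' (i * 2) \<subseteq> ...\<close>, whose term with
    index \<open>i * m\<close> is \<open>V\<close> again; the resulting equality contradicts the
    minimality of the period.\<close>
  have not_sub: "\<not> V \<subseteq> V' i" if i: "1 \<le> i" "i < m" for i
  proof
    assume sub: "V \<subseteq> V' i"
    have "V' (i * k) \<subseteq> V' (i * Suc k)" for k
      using image_mono[OF sub, of "?f ^^ (i * k)"] V'_funpow[of "i * k" 0] V'_funpow[of "i * k" i]
      by (simp add: V'_0 add.commute)
    then have mono: "V' (i * k) \<subseteq> V' (i * l)" if "k \<le> l" for k l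
      using lift_Suc_mono_le[of "\<lambda>k. V' (i * k)", OF _ that] by blast
    have "V' (i * m) = V" using V'_mod[of "i * m"] V'_0 by simp
    then have "V' i \<subseteq> V" using mono[of 1 m] m by simp
    then show False using sub least[OF i] unfolding V'_def by blast
  qed
  \<comment> \<open>By irreducibility \<open>V\<close> is not covered by the finitely many other
    translates, so removing them leaves a nonempty set invariant under
    \<open>?f ^^ m\<close>.\<close>
  define D where "D = (\<Union>i\<in>{1..<m}. V' i)"
  have D: "closedin ?Z D" unfolding D_def using closed by (intro closedin_Union) auto
  have "V - D \<noteq> {}"
    using irreducible_closed_subset_Union[OF irr, of "{1..<m}" V'] closed not_sub
    unfolding D_def by fastforce
  moreover have "(?f ^^ m) ` (V - D) = V - D"
  proof -
    have "(?f ^^ m) ` D = D" unfolding D_def by (simp add: image_UN V'_period)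
    then show ?thesis using m by (simp add: image_set_diff[OF injf])
  qed
  ultimately have "\<exists>P\<in>V - D. coords_prod P None = 0"
    using closed[of 0] D m(1)
    by (intro shift_invariant_meets_fibre[OF surj_coords_prod, where \<phi> = "?f ^^ m" and m = m])
      (auto simp: fst_skew_map_funpow V'_0)
  then obtain P where P: "P \<in> V" "P \<notin> D" "fst P = 0" by auto
  define w where "w = snd P"
  have "P = (0, w)" using P(3) by (simp add: w_def prod_eq_iff)
  then have w: "(0, w) \<in> V" "(0, w) \<notin> D" using P by auto
  have w_V': "m dvd i" if "(0, w) \<in> V' i" for i
  proof (rule ccontr)
    assume "\<not> m dvd i"
    then have "i mod m \<noteq> 0" by (simp add: mod_eq_0_iff_dvd)
    then have "i mod m \<in> {1..<m}" using m by auto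
    moreover have "(0, w) \<in> V' (i mod m)" using that V'_mod by blast
    ultimately show False using w(2) unfolding D_def by blast
  qed
  have ex: "\<exists>i<m. (0, g *v w) \<in> V' i" if g: "g \<in> ?G" for g
  proof -
    have I: "(\<Union>l<m. V' l) \<in> invariant_dominant A"
      using invariant_dominant_orbit[OF A _ _ m] irr unfolding irreducible_closed_def V'_def by blast
    have "(0, w) \<in> (\<Union>l<m. V' l)" using w(1) V'_0 m(1) by auto
    then have "(0, g *v w) \<in> (\<Union>l<m. V' l)" by (simp only: group_of_fibre[OF I g])
    then show ?thesis by blast
  qed
  have unique: "i = j" if g: "g \<in> ?G" and ij: "i < m" "j < m"
    and mem: "(0, g *v w) \<in> V' i" "(0, g *v w) \<in> V' j" for g i j
  proof -
    let ?X = "V' i \<inter> V' j"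
    have image_Int': "(?f ^^ l) ` ?X = V' (l + i) \<inter> V' (l + j)" for l
      by (simp add: image_Int[OF injf] V'_funpow)
    have "(?f ^^ m) ` ?X = ?X" by (simp add: image_Int[OF injf] V'_period)
    then have I: "(\<Union>l<m. (?f ^^ l) ` ?X) \<in> invariant_dominant A"
      using closed mem by (intro invariant_dominant_orbit[OF A _ _ m(1)]) auto
    have "(0, g *v w) \<in> (?f ^^ 0) ` ?X" using mem by auto
    then have "(0, g *v w) \<in> (\<Union>l<m. (?f ^^ l) ` ?X)" using m(1) by (intro UN_I[of 0]) auto
    then have "(0, w) \<in> (\<Union>l<m. (?f ^^ l) ` ?X)" by (simp only: group_of_fibre[OF I g])
    then obtain l where "(0, w) \<in> V' (l + i)" "(0, w) \<in> V' (l + j)" unfolding image_Int' by blast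
    then have "m dvd l + i" "m dvd l + j" using w_V' by blast+
    \<comment> \<open>Subtraction on \<open>nat\<close> truncates, so both differences are used to
      conclude \<open>i = j\<close>.\<close>
    then have "m dvd i - j" "m dvd j - i"
      using dvd_diff_nat[of m "l + i" "l + j"] dvd_diff_nat[of m "l + j" "l + i"] by simp_all
    then have "i - j = 0" "j - i = 0"
      using ij by (metis nat_dvd_not_less less_imp_diff_less gr0I)+
    then show ?thesis by simp
  qed
  \<comment> \<open>The property \<open>hX\<close> serves twice: for invariant sets it shows
    \<open>h \<in> ?G\<close>, and for the sets \<open>V' i\<close> it shows that \<open>h\<close>
    advances the index by one.\<close>
  obtain h where h: "invertible h" and
    hX: "\<And>X u. closedin ?Z X \<Longrightarrow> (?f ^^ m) ` X = X \<Longrightarrow> (0, u) \<in> X \<Longrightarrow> (0, h *v u) \<in> ?f ` X"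
    using exists_shift_matrix[OF A m(1)] by blast
  have hG: "h \<in> ?G"
  proof (rule group_of_shift_matrix[OF h])
    fix X :: "('a \<times> ('a^'n)) set" and u
    assume X: "closedin ?Z X" "?f ` X = X" "(0, u) \<in> X"
    have "(?f ^^ m) ` X = X" using funpow_image_multiple[of 1 ?f X m] X(2) by simp
    then show "(0, h *v u) \<in> X" using hX[of X u] X by simp
  qed
  have shift: "(0, (h ** g) *v w) \<in> V' ((i + 1) mod m)" if "(0, g *v w) \<in> V' i" for g i
  proof -
    have "(0, h *v (g *v w)) \<in> ?f ` V' i" using hX[OF closed V'_period that] .
    also have "?f ` V' i = V' (i + 1)" using V'_funpow[of 1 i] by simp
    finally show ?thesis using V'_mod by (simp add: matrix_vector_mul_assoc)
  qed
  let ?X = "subtopology (zariski coords_mat) ?G"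
  define S where "S i = {g. (0, g *v w) \<in> V' i}" for i
  have S_closed: "closedin (zariski coords_mat) (S i)" for i
  proof -
    have "(\<lambda>g. coords_prod (0, g *v w) v) \<in> polyfun (coords_mat :: 'a^'n^'n \<Rightarrow> _)" for v
      by (rule polyfun_coords_prodI) (auto simp: matrix_vector_mult_def intro!: polyfun_intros)
    from closedin_vimage[of coords_prod "\<lambda>g. (0, g *v w)", OF this closed]
    show ?thesis by (simp add: S_def vimage_def)
  qed
  have conn: "\<exists>i<m. K \<subseteq> S i" if K: "K \<in> group_components A" for K
  proof -
    have KG: "K \<noteq> {}" "K \<subseteq> ?G" "connectedin (zariski coords_mat) K"
      using K nonempty_connected_components_of connectedin_connected_components_of[of K ?X]
      by (auto simp: group_components_def connectedin_subtopology)
    then obtain g i where g: "g \<in> K" "i < m" "g \<in> S i" using ex unfolding S_def by blast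
    \<comment> \<open>On \<open>K\<close> the closed sets \<open>S i\<close> and \<open>?T\<close>
      are disjoint and cover, so connectedness leaves only \<open>S i\<close>, which contains
      \<open>g\<close>.\<close>
    let ?T = "\<Union>j\<in>{..<m} - {i}. S j"
    have "closedin (zariski coords_mat) ?T" using S_closed by (intro closedin_Union) auto
    moreover have "K \<subseteq> S i \<union> ?T" using KG(2) ex unfolding S_def by fastforce
    moreover have "S i \<inter> ?T \<inter> K = {}" using unique KG(2) g(2) unfolding S_def by blast
    ultimately have "?T \<inter> K = {}"
      using KG(3) S_closed[of i] g unfolding connectedin_closedin by blast
    then have "K \<subseteq> S i" using \<open>K \<subseteq> S i \<union> ?T\<close> by blast
    then show ?thesis using g by blast
  qed
  then obtain \<tau> where \<tau>: "\<And>K. K \<in> group_components A \<Longrightarrow> \<tau> K < m \<and> K \<subseteq> S (\<tau> K)" by metis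
  let ?T = "image (\<lambda>M. h ** M)"
  have hom: "homeomorphic_map ?X ?X (\<lambda>M. h ** M)"
    by (rule homeomorphic_map_group_translation[OF hG h])
  have T_image: "?T ` group_components A = group_components A"
    using homeomorphic_map_connected_components_of[OF hom] unfolding group_components_def by simp
  have "m dvd card (group_components A)"
  proof (rule dvd_card_if_cyclic_shift)
    show "finite (group_components A)"
      unfolding group_components_def by (rule finite_connected_components_zariski)
    show "\<tau> K < m" if "K \<in> group_components A" for K using \<tau> that by blast
    have inj: "inj (\<lambda>M. h ** M)"
    proof (rule injI)
      fix M N assume "h ** M = h ** N"
      moreover obtain g where "g ** h = mat 1" using h unfolding invertible_def by blast
      ultimately show "M = N" by (metis matrix_mul_assoc matrix_mul_lid)
    qed
    show "inj_on ?T (group_components A)"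
      by (rule inj_onI) (simp only: inj_image_eq_iff[OF inj])
    show "?T ` group_components A \<subseteq> group_components A" using T_image by simp
    \<comment> \<open>A single element of a component determines its label, by uniqueness of the
      index; the translate by \<open>h\<close> therefore has the next label.\<close>
    fix K assume K: "K \<in> group_components A"
    then obtain g where g: "g \<in> K"
      using nonempty_connected_components_of unfolding group_components_def by blast
    have TK: "?T K \<in> group_components A" using K T_image by blast
    then have "h ** g \<in> ?G"
      using g connected_components_of_subset[of "?T K" ?X] unfolding group_components_def by auto
    moreover have "(0, (h ** g) *v w) \<in> V' ((\<tau> K + 1) mod m)"
      using shift \<tau>[OF K] g unfolding S_def by blast
    moreover have "(0, (h ** g) *v w) \<in> V' (\<tau> (?T K))"
      using \<tau>[OF TK] g unfolding S_def by blast
    ultimately show "\<tau> (?T K) = (\<tau> K + 1) mod m"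
      using unique[of "h ** g"] \<tau>[OF TK] m(1) by simp
  qed
  then show ?thesis unfolding m_def .
qed

theorem corollary3p9:
  fixes A :: "'a::{alg_closed_field, field_char_0} poly^'n^'n"
  assumes "invertible A"
  shows "finite (group_components A) \<and>
    (\<forall>V m. periodic_subvariety A V \<and> period A V = m \<longrightarrow> m dvd card (group_components A)) \<and>
    (\<exists>C. \<forall>V. periodic_subvariety A V \<longrightarrow> period A V \<le> C)"
proof -
  have fin: "finite (group_components A)"
    unfolding group_components_def by (rule finite_connected_components_zariski)
  \<comment> \<open>Every number divides 0, so the count must be shown to be positive before
    divisibility bounds the period.\<close>
  have "group_components A \<noteq> {}"
    using mat_1_in_group_of[of A] topspace_subtopology[of "zariski coords_mat" "group_of A"]
    unfolding group_components_def connected_components_of_eq_empty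
    by (auto simp flip: null_topspace_iff_trivial)
  then have "card (group_components A) > 0" using fin by (simp add: card_gt_0_iff)
  then show ?thesis
    using fin period_dvd_components[OF assms] dvd_imp_le by blast
qed

end
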